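(* Let $\mathcal T$ be a simple quadrilateral tiling of a closed, connected, orientable surface of positive genus, let $R$ be a ring, and let $n\ge|B(\mathcal T)|-1$, where $B(\mathcal T)$ is the set of black vertices of $\mathcal T$. Then the incidence theorem in $\mathbb P^n(R)$ associated with $\mathcal T$ holds if and only if the group of units $R^\times$ is commutative.
   Context: A polygonal subdivision of a closed surface is a cellular decomposition in which the closure of every $2$-cell is an embedded polygon with at least two vertices. A quadrilateral tiling is a polygonal subdivision in which all faces (tiles) are quadrilaterals and vertices are colored black and white so that every edge joins vertices of different colors; it is simple if no two edges join the same pair of vertices. For a left $R$-module $M$: a point of $\mathbb P(M)$ is a free rank-one submodule $A\subset M$ that is a direct summand of $M$; a hyperplane is a submodule $\ell\subset M$ with $M=A\oplus\ell$ for some point $A$; a point $A$ and hyperplane $\ell$ are non-neighboring if $M=A\oplus\ell$. $\mathbb P^n(R)=\mathbb P(R^{n+1})$ with $R^{n+1}$ the free left module. A realization of $\mathcal T$ in $\mathbb P^n(R)$ assigns a point to each black vertex and a hyperplane to each white vertex so that for every edge the point and hyperplane at its endpoints are non-neighboring. A tile with black-vertex points $A_1,A_2$ and white-vertex hyperplanes $\ell_1,\ell_2$ is coherent if $(A_1+A_2)\cap\ell_1=(A_1+A_2)\cap\ell_2$. The incidence theorem associated with $\mathcal T$ in $\mathbb P^n(R)$ is: for every realization of $\mathcal T$ in $\mathbb P^n(R)$, if all tiles except one are coherent, then the remaining tile is coherent. *)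

theory Defs
  imports "HOL-Analysis.Analysis"
begin

section \<open>Closed surfaces and polygonal subdivisions\<close>

definition closed_surface :: "'a topology \<Rightarrow> bool" where
  "closed_surface X \<longleftrightarrow>
     topspace X \<noteq> {} \<and> compact_space X \<and> Hausdorff_space X \<and>
     (\<forall>x\<in>topspace X. \<exists>U. openin X U \<and> x \<in> U \<and>
        subtopology X U homeomorphic_space (euclidean :: (real ^ 2) topology))"

text \<open>
  The model \<open>k\<close>-gon is the closed unit disc in the complex plane, with the \<open>k\<close>-th roots of unity
  as vertices and the closed circular arcs between consecutive ones as sides, listed
  counterclockwise. This also makes sense for \<open>k = 2\<close>.
\<close>

definition corner :: "nat \<Rightarrow> nat \<Rightarrow> complex" where
  "corner k j = cis (2 * pi * real j / real k)"

definition side :: "nat \<Rightarrow> nat \<Rightarrow> complex set" where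
  "side k j = cis ` {2 * pi * real j / real k .. 2 * pi * real (Suc j) / real k}"

text \<open>
  Vertices are points of \<open>X\<close>; edges and tiles are represented by the \<^emph>\<open>closed\<close> cells, as
  subsets of \<open>X\<close>. A closed edge is an arc that meets the vertex set exactly in its two end points
  (loops cannot occur as sides of embedded polygons).
\<close>

definition edge_arc :: "'a topology \<Rightarrow> 'a set \<Rightarrow> 'a set \<Rightarrow> bool" where
  "edge_arc X V e \<longleftrightarrow>
     e \<subseteq> topspace X \<and>
     (\<exists>c. homeomorphic_map (top_of_set {0..1::real}) (subtopology X e) c \<and>
          e \<inter> V = {c 0, c 1})"

text \<open>
  \<open>d\<close> exhibits the closed cell \<open>t\<close> as an embedded \<open>k\<close>-gon: a homeomorphism from the model polygon
  onto \<open>t\<close> that takes vertices to vertices and sides to edges, and whose restriction to the open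
  disc parametrizes the open cell.
\<close>

definition polygon_chart ::
  "'a topology \<Rightarrow> 'a set \<Rightarrow> 'a set set \<Rightarrow> nat \<Rightarrow> 'a set \<Rightarrow> (complex \<Rightarrow> 'a) \<Rightarrow> bool" where
  "polygon_chart X V E k t d \<longleftrightarrow>
     t \<subseteq> topspace X \<and>
     homeomorphic_map (top_of_set (cball 0 1)) (subtopology X t) d \<and>
     (\<forall>j<k. d (corner k j) \<in> V \<and> d ` side k j \<in> E) \<and>
     d ` ball 0 1 \<inter> (V \<union> \<Union>E) = {}"

text \<open>
  The open cells are the vertices, the sets \<open>e - V\<close> for edges \<open>e\<close> and the sets \<open>t - \<Union>E\<close> for
  tiles \<open>t\<close>; the last three conditions say that they partition \<open>X\<close>.
\<close>

definition polygonal_subdivision ::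
  "'a topology \<Rightarrow> 'a set \<Rightarrow> 'a set set \<Rightarrow> 'a set set \<Rightarrow> bool" where
  "polygonal_subdivision X V E F \<longleftrightarrow>
     finite V \<and> finite E \<and> finite F \<and> V \<subseteq> topspace X \<and>
     (\<forall>e\<in>E. edge_arc X V e) \<and>
     (\<forall>t\<in>F. \<exists>k\<ge>2. \<exists>d. polygon_chart X V E k t d) \<and>
     topspace X = V \<union> \<Union>E \<union> \<Union>F \<and>
     (\<forall>e\<in>E. \<forall>e'\<in>E. e \<noteq> e' \<longrightarrow> e \<inter> e' \<subseteq> V) \<and>
     (\<forall>t\<in>F. \<forall>t'\<in>F. t \<noteq> t' \<longrightarrow> t \<inter> t' \<subseteq> \<Union>E)"

text \<open>
  Orientability, read off from the subdivision: the tiles can be oriented so that any two tiles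
  with a common edge induce opposite directions on it. A chart \<open>d\<close> orients its tile; the
  direction it induces on \<open>d ` side k j\<close> starts at the vertex \<open>d (corner k j)\<close>. An edge is
  determined by the set \<open>d ` side k j\<close> and has two distinct end points, so opposite directions
  means different starting points.
\<close>

definition orientable_subdivision ::
  "'a topology \<Rightarrow> 'a set \<Rightarrow> 'a set set \<Rightarrow> 'a set set \<Rightarrow> bool" where
  "orientable_subdivision X V E F \<longleftrightarrow>
     (\<exists>k d. (\<forall>t\<in>F. k t \<ge> 2 \<and> polygon_chart X V E (k t) t (d t)) \<and>
       (\<forall>t\<in>F. \<forall>t'\<in>F. t \<noteq> t' \<longrightarrow>
          (\<forall>i<k t. \<forall>j<k t'.
             d t ` side (k t) i = d t' ` side (k t') j \<longrightarrow>
             d t (corner (k t) i) \<noteq> d t' (corner (k t') j))))"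

definition euler_characteristic :: "'a set \<Rightarrow> 'a set set \<Rightarrow> 'a set set \<Rightarrow> int" where
  "euler_characteristic V E F = int (card V) - int (card E) + int (card F)"

text \<open>The genus \<open>g\<close> of a closed connected orientable surface, given by \<open>\<chi> = 2 - 2 g\<close>.\<close>

definition has_genus :: "'a set \<Rightarrow> 'a set set \<Rightarrow> 'a set set \<Rightarrow> nat \<Rightarrow> bool" where
  "has_genus V E F g \<longleftrightarrow> euler_characteristic V E F = 2 - 2 * int g"


section \<open>Quadrilateral tilings\<close>

text \<open>\<open>B\<close> and \<open>W\<close> are the sets of black and of white vertices.\<close>

definition quadrilateral_tiling ::
  "'a topology \<Rightarrow> 'a set \<Rightarrow> 'a set \<Rightarrow> 'a set set \<Rightarrow> 'a set set \<Rightarrow> bool" where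
  "quadrilateral_tiling X B W E F \<longleftrightarrow>
     polygonal_subdivision X (B \<union> W) E F \<and>
     (\<forall>t\<in>F. \<exists>d. polygon_chart X (B \<union> W) E 4 t d) \<and>
     B \<inter> W = {} \<and>
     (\<forall>e\<in>E. \<exists>b\<in>B. \<exists>w\<in>W. e \<inter> (B \<union> W) = {b, w})"

definition simple_subdivision :: "'a set \<Rightarrow> 'a set set \<Rightarrow> bool" where
  "simple_subdivision V E \<longleftrightarrow> (\<forall>e\<in>E. \<forall>e'\<in>E. e \<inter> V = e' \<inter> V \<longrightarrow> e = e')"


section \<open>Projective space over a ring\<close>

text \<open>
  A unital ring that need not be commutative is a type of sort \<open>{ring, monoid_mult}\<close>; in contrast
  to \<open>ring_1\<close> this allows \<open>0 = 1\<close>. The free left module of rank \<open>CARD('n)\<close> is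
  \<open>'r ^ 'n\<close> with the left multiplication \<open>*s\<close>.
\<close>

definition submodule :: "(('r::{ring,monoid_mult}) ^ 'n) set \<Rightarrow> bool" where
  "submodule A \<longleftrightarrow>
     0 \<in> A \<and> (\<forall>x\<in>A. \<forall>y\<in>A. x + y \<in> A) \<and> (\<forall>c. \<forall>x\<in>A. c *s x \<in> A)"

definition submodule_sum ::
  "(('r::{ring,monoid_mult}) ^ 'n) set \<Rightarrow> ('r ^ 'n) set \<Rightarrow> ('r ^ 'n) set" where
  "submodule_sum A A' = {x + y |x y. x \<in> A \<and> y \<in> A'}"

definition complementary ::
  "(('r::{ring,monoid_mult}) ^ 'n) set \<Rightarrow> ('r ^ 'n) set \<Rightarrow> bool" where
  "complementary A L \<longleftrightarrow> submodule_sum A L = UNIV \<and> A \<inter> L = {0}"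

definition free_rank_one :: "(('r::{ring,monoid_mult}) ^ 'n) set \<Rightarrow> bool" where
  "free_rank_one A \<longleftrightarrow> (\<exists>a. A = range (\<lambda>c. c *s a) \<and> (\<forall>c. c *s a = 0 \<longrightarrow> c = 0))"

definition proj_point :: "(('r::{ring,monoid_mult}) ^ 'n) set \<Rightarrow> bool" where
  "proj_point A \<longleftrightarrow>
     submodule A \<and> free_rank_one A \<and> (\<exists>N. submodule N \<and> complementary A N)"

definition proj_hyperplane :: "(('r::{ring,monoid_mult}) ^ 'n) set \<Rightarrow> bool" where
  "proj_hyperplane L \<longleftrightarrow> submodule L \<and> (\<exists>A. proj_point A \<and> complementary A L)"

definition non_neighboring ::
  "(('r::{ring,monoid_mult}) ^ 'n) set \<Rightarrow> ('r ^ 'n) set \<Rightarrow> bool" where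
  "non_neighboring A L \<longleftrightarrow> complementary A L"

definition ring_units :: "('r::{ring,monoid_mult}) set" where
  "ring_units = {u. \<exists>v. u * v = 1 \<and> v * u = 1}"


section \<open>Realizations and incidence theorems\<close>

definition realization ::
  "'a set \<Rightarrow> 'a set \<Rightarrow> 'a set set \<Rightarrow>
   ('a \<Rightarrow> (('r::{ring,monoid_mult}) ^ 'n) set) \<Rightarrow> ('a \<Rightarrow> ('r ^ 'n) set) \<Rightarrow> bool" where
  "realization B W E P H \<longleftrightarrow>
     (\<forall>b\<in>B. proj_point (P b)) \<and> (\<forall>w\<in>W. proj_hyperplane (H w)) \<and>
     (\<forall>e\<in>E. \<forall>b\<in>e \<inter> B. \<forall>w\<in>e \<inter> W. non_neighboring (P b) (H w))"

definition coherent ::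
  "'a set \<Rightarrow> 'a set \<Rightarrow>
   ('a \<Rightarrow> (('r::{ring,monoid_mult}) ^ 'n) set) \<Rightarrow> ('a \<Rightarrow> ('r ^ 'n) set) \<Rightarrow> 'a set \<Rightarrow> bool" where
  "coherent B W P H t \<longleftrightarrow>
     (\<forall>b\<^sub>1 b\<^sub>2 w\<^sub>1 w\<^sub>2. t \<inter> B = {b\<^sub>1, b\<^sub>2} \<and> t \<inter> W = {w\<^sub>1, w\<^sub>2} \<longrightarrow>
        submodule_sum (P b\<^sub>1) (P b\<^sub>2) \<inter> H w\<^sub>1 = submodule_sum (P b\<^sub>1) (P b\<^sub>2) \<inter> H w\<^sub>2)"

text \<open>
  The incidence theorem in the projective space of the module \<open>'r ^ 'n\<close>, which is
  \<open>n\<close>-dimensional projective space over \<open>'r\<close> for \<open>CARD('n) = n + 1\<close>.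
\<close>

definition incidence_theorem ::
  "('r::{ring,monoid_mult}) itself \<Rightarrow> ('n::finite) itself \<Rightarrow>
   'a set \<Rightarrow> 'a set \<Rightarrow> 'a set set \<Rightarrow> 'a set set \<Rightarrow> bool" where
  "incidence_theorem _ _ B W E F \<longleftrightarrow>
     (\<forall>(P :: 'a \<Rightarrow> ('r ^ 'n) set) (H :: 'a \<Rightarrow> ('r ^ 'n) set).
        realization B W E P H \<longrightarrow>
        (\<forall>t\<^sub>0\<in>F. (\<forall>t\<in>F - {t\<^sub>0}. coherent B W P H t) \<longrightarrow> coherent B W P H t\<^sub>0))"

end

theory Submission
  imports Defs "HOL-Library.Multiset" "HOL-Library.Sublist"
begin

text \<open>
  Writing a hyperplane as the kernel of a functional, a realization becomes a labelling of the
  edges by units, and a tile is coherent iff the product of the labels around it (with inverses for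
  edges traversed backwards) is \<open>1\<close>. If the units commute, the product over all tiles of an
  oriented closed surface is \<open>1\<close>, since each edge occurs once in each direction.

  Conversely, glue the tiles along edges to the tile \<open>t\<^sub>0\<close>, one after the other, until a single
  polygon remains, whose sides are identified in pairs. Every labelling of the remaining edges
  extends over the glued ones so that all tiles but \<open>t\<^sub>0\<close> become flat,
      and the holonomy of \<open>t\<^sub>0\<close>
  is the product along the boundary of the polygon. If no two pairs of sides were linked, the
  polygon would close up to a sphere, against \<open>g > 0\<close>. So two pairs are linked,
      and labelling
  them by non-commuting units \<open>u\<close>, \<open>v\<close> and all others
      by \<open>1\<close> gives a commutator around \<open>t\<^sub>0\<close>.
  Since there is room for independent points, every labelling by units comes from a realization.
\<close>

section \<open>Words of directed edges\<close>

text \<open>The contradiction in the last polygon is a count of vertices, and gluing words must not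
  lose track of which corners are the same point. The condition \<open>one_orbit_per_vertex\<close>
  keeps this record. The local structure of the surface enters only to establish it, through the
  absence of pinch points, and to put every vertex on an edge and every edge on two tiles. Under
  this condition a polygon without linked pairs has at least one more vertex than edges, that is,
  \<chi> \<ge> 2. Each gluing removes one edge and one face and creates no vertex, so \<chi> never
  grows from its initial value \<le> 0; no classification of surfaces is involved. Labels need not
  commute, so products must be kept in order. This is why all tiles are absorbed into the word of
  \<open>t0\<close>: its holonomy is then literally the product along the growing boundary.
  Simplicity allows an edge to be identified with its pair of ends. The bound on \<open>n\<close>
  provides one basis vector per black vertex, on which a functional can take arbitrary prescribed
  values.\<close>

text \<open>
  An edge of a simple graph with a direction is a pair of vertices, and a face is the cyclic word
  of the directed edges along its boundary; \<open>prod.swap\<close> reverses an edge. The reversal of \<open>x\<close>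
  and the successor of \<open>x\<close> in a word start at the same vertex
      and are neighbours in the rotation
  around it. A set invariant under passing between such neighbours is a union of orbits.
\<close>

definition cyc_invariant ::
    "('v \<times> 'v) set \<Rightarrow> ('v \<times> 'v) list \<Rightarrow> bool" where
  "cyc_invariant S w \<longleftrightarrow> (\<forall>(x, y) \<in> set (zip w (rotate1 w)). prod.swap x \<in> S \<longleftrightarrow> y \<in> S)"

text \<open>Quantifying over all invariant sets \<open>S\<close> expresses that edges leaving the
  same vertex lie in the same orbit, without defining the rotation as a permutation. For a surface
  it excludes discs pinched together at a vertex.\<close>

definition one_orbit_per_vertex :: "('v \<times> 'v) list list \<Rightarrow> bool" where
  "one_orbit_per_vertex Ws \<longleftrightarrow>
     (\<forall>S. (\<forall>w\<in>set Ws. cyc_invariant S w) \<longrightarrow>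
        (\<forall>x\<in>set (concat Ws). \<forall>y\<in>set (concat Ws). fst x = fst y \<longrightarrow> (x \<in> S \<longleftrightarrow> y \<in> S)))"

text \<open>The combinatorial form of a closed oriented surface: each directed edge occurs exactly
  once, and so does its reversal. Distinct ends keep an edge from being its own reversal.\<close>

definition scheme :: "('v \<times> 'v) list list \<Rightarrow> bool" where
  "scheme Ws \<longleftrightarrow> distinct (concat Ws) \<and>
      prod.swap ` set (concat Ws) \<subseteq> set (concat Ws) \<and>
     (\<forall>x\<in>set (concat Ws). fst x \<noteq> snd x)"

text \<open>Connectedness of the dual graph, phrased through families of words closed under crossing
  an edge instead of paths.\<close>

definition gluing_connected :: "('v \<times> 'v) list list \<Rightarrow> bool" where
  "gluing_connected Ws \<longleftrightarrow>
     (\<forall>K\<subseteq>set Ws. K \<noteq> {} \<longrightarrow> prod.swap ` (\<Union>w\<in>K. set w) \<subseteq> (\<Union>w\<in>K. set w) \<longrightarrow> K = set Ws)"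

text \<open>On a set closed under reversal, the equation for the reversed edge makes the inverse
  two-sided, so all labels are units.\<close>

definition edge_labelling ::
    "('v \<times> 'v) set \<Rightarrow> ('v \<times> 'v \<Rightarrow> 'g::monoid_mult) \<Rightarrow> bool" where
  "edge_labelling D f \<longleftrightarrow> (\<forall>x\<in>D. f x * f (prod.swap x) = 1)"

definition holonomy ::
    "('d \<Rightarrow> 'g::monoid_mult) \<Rightarrow> 'd list \<Rightarrow> 'g" where
  "holonomy f w = prod_list (map f w)"

lemma one_orbit_per_vertexD:
  assumes "one_orbit_per_vertex Ws" "\<And>w. w \<in> set Ws \<Longrightarrow> cyc_invariant S w"
    and "x \<in> set (concat Ws)" "y \<in> set (concat Ws)" "fst x = fst y"
  shows "x \<in> S \<longleftrightarrow> y \<in> S"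
  using assms unfolding one_orbit_per_vertex_def by blast

lemma schemeD:
  assumes "scheme Ws"
  shows "distinct (concat Ws)" "prod.swap ` set (concat Ws) \<subseteq> set (concat Ws)"
    "x \<in> set (concat Ws) \<Longrightarrow> fst x \<noteq> snd x"
  using assms unfolding scheme_def by blast+

lemma gluing_connectedD:
  assumes "gluing_connected Ws" "K \<subseteq> set Ws" "K \<noteq> {}"
    and "prod.swap ` (\<Union>w\<in>K. set w) \<subseteq> (\<Union>w\<in>K. set w)"
  shows "K = set Ws"
  using assms unfolding gluing_connected_def by blast

lemma holonomy_simps [simp]:
  "holonomy f [] = 1" "holonomy f (x # w) = f x * holonomy f w"
  "holonomy f (v @ w) = holonomy f v * holonomy f w"
  by (simp_all add: holonomy_def)

lemma holonomy_cong: "(\<And>x. x \<in> set w \<Longrightarrow> f x = g x) \<Longrightarrow>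
    holonomy f w = holonomy g w"
  unfolding holonomy_def by (metis map_cong)

lemma cyc_invariant_rotate: "cyc_invariant S (v @ w) \<longleftrightarrow> cyc_invariant S (w @ v)"
proof -
  have r1: "set (zip (rotate1 u) (rotate1 (rotate1 u))) = set (zip u (rotate1 u))" for u ::
      "('v \<times> 'v) list"
  proof -
    have "length v = length u \<Longrightarrow> zip (rotate1 u) (rotate1 v) = rotate1 (zip u v)"
      for v :: "('v \<times> 'v) list"
      by (cases u; cases v) simp_all
    then have "zip (rotate1 u) (rotate1 (rotate1 u)) = rotate1 (zip u (rotate1 u))" by simp
    then show ?thesis by simp
  qed
  have "set (zip (rotate n u) (rotate1 (rotate n u))) = set (zip u (rotate1 u))" for n and u ::
      "('v \<times> 'v) list"
    by (induction n) (simp_all add: r1)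
  from this[of "length v" "v @ w"] show ?thesis
    by (simp add: cyc_invariant_def rotate_append)
qed

lemma cyc_invariant_nth:
  "cyc_invariant S w \<longleftrightarrow> (\<forall>j<length w. prod.swap (w ! j) \<in> S \<longleftrightarrow> w ! (Suc j mod length w) \<in> S)"
proof -
  have "set (zip w (rotate1 w)) = {(w ! j, w ! (Suc j mod length w)) |j. j < length w}"
    unfolding set_zip by (auto simp: nth_rotate1)
  show ?thesis unfolding cyc_invariant_def \<open>set (zip w (rotate1 w)) = _\<close> by blast
qed

lemma cyc_invariant_Cons:
  fixes S :: "('v \<times> 'v) set"
  assumes "w \<noteq> []"
  shows "cyc_invariant S (x # w) \<longleftrightarrow>
    (prod.swap x \<in> S \<longleftrightarrow> hd w \<in> S) \<and> (prod.swap (last w) \<in> S \<longleftrightarrow> x \<in> S) \<and>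
    (\<forall>(a, b)\<in>set (zip w (tl w)). prod.swap a \<in> S \<longleftrightarrow> b \<in> S)"
proof -
  obtain y v where w: "w = y # v" using assms by (cases w) auto
  have "set (zip (y # v) (v @ [x])) = set (zip (y # v) v) \<union> {(last (y # v), x)}" for y
      and v :: "('v \<times> 'v) list"
    by (induction v arbitrary: y) auto
  then show ?thesis by (auto simp: cyc_invariant_def w simp del: last.simps)
qed

lemma cyc_invariant_nonempty:
  assumes "w \<noteq> []"
  shows "cyc_invariant S w \<longleftrightarrow>
    (prod.swap (last w) \<in> S \<longleftrightarrow> hd w \<in> S) \<and>
    (\<forall>(a, b)\<in>set (zip w (tl w)). prod.swap a \<in> S \<longleftrightarrow> b \<in> S)"
proof (cases "tl w = []")
  case True
  then obtain x where "w = [x]" using assms by (metis list.collapse)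
  then show ?thesis by (simp add: cyc_invariant_def)
next
  case False
  obtain x v where w: "w = x # v" using assms by (cases w) auto
  with False obtain y u where v: "v = y # u" by (cases v) auto
  show ?thesis using cyc_invariant_Cons[of v S x] by (auto simp: w v)
qed

lemma zip_tl_append:
  assumes "v \<noteq> []" "w \<noteq> []"
  shows "set (zip (v @ w) (tl (v @ w))) =
    set (zip v (tl v)) \<union> {(last v, hd w)} \<union> set (zip w (tl w))"
  using assms
proof (induction v)
  case (Cons a v)
  then show ?case by (cases v; cases w) auto
qed simp

text \<open>Separates the two seams of a cyclic word from its inner corners; gluing changes only the
  seams.\<close>

lemma cyc_invariant_append:
  assumes "v \<noteq> []" "w \<noteq> []"
  shows "cyc_invariant S (v @ w) \<longleftrightarrow>
    (prod.swap (last v) \<in> S \<longleftrightarrow> hd w \<in> S) \<and> (prod.swap (last w) \<in> S \<longleftrightarrow> hd v \<in> S) \<and>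
    (\<forall>(a, b)\<in>set (zip v (tl v)). prod.swap a \<in> S \<longleftrightarrow> b \<in> S) \<and>
    (\<forall>(a, b)\<in>set (zip w (tl w)). prod.swap a \<in> S \<longleftrightarrow> b \<in> S)"
proof -
  have "v @ w \<noteq> []" using assms by simp
  show ?thesis unfolding cyc_invariant_nonempty[OF \<open>v @ w \<noteq> []\<close>] zip_tl_append[OF assms]
    using assms by (auto simp del: append_is_Nil_conv)
qed

lemma set_zip_tl: "(a, b) \<in> set (zip w (tl w)) \<Longrightarrow> a \<in> set w \<and>
    b \<in> set w"
  by (cases w) (auto dest: set_zip_leftD set_zip_rightD)

lemma holonomy_inverse:
  assumes "edge_labelling D f" "set w \<subseteq> D"
  shows "holonomy f w * holonomy (\<lambda>x. f (prod.swap x)) (rev w) = 1"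
  using assms(2)
proof (induction w)
  case (Cons x w)
  let ?h = "holonomy (\<lambda>x. f (prod.swap x)) (rev w)"
  have "holonomy f (x # w) * holonomy (\<lambda>x. f (prod.swap x)) (rev (x # w)) =
    f x * (holonomy f w * ?h) * f (prod.swap x)" by (simp add: mult.assoc)
  also have "\<dots> = 1" using Cons assms(1) by (simp add: edge_labelling_def)
  finally show ?case .
qed simp

lemma holonomy_inverse':
  assumes "edge_labelling D f" "set w \<subseteq> D" "prod.swap ` D \<subseteq> D"
  shows "holonomy (\<lambda>x. f (prod.swap x)) (rev w) * holonomy f w = 1"
proof -
  have "edge_labelling D (\<lambda>x. f (prod.swap x))"
    using assms(1,3) by (fastforce simp: edge_labelling_def image_subset_iff)
  from holonomy_inverse[OF this, of "rev w"] assms(2) show ?thesis by simp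
qed

text \<open>Changing the starting point conjugates the holonomy by a unit, and \<open>1\<close> is
  fixed by conjugation.\<close>

lemma holonomy_rotate_eq_one:
  assumes "edge_labelling D f" "set v \<subseteq> D" "prod.swap ` D \<subseteq> D"
    and "holonomy f (v @ w) = 1"
  shows "holonomy f (w @ v) = 1"
proof -
  let ?i = "holonomy (\<lambda>x. f (prod.swap x)) (rev v)"
  have l: "?i * holonomy f v = 1" and r: "holonomy f v * ?i = 1"
    using holonomy_inverse'[OF assms(1-3)] holonomy_inverse[OF assms(1,2)] by auto
  have "holonomy f w = ?i * (holonomy f v * holonomy f w)" using l by (simp flip: mult.assoc)
  then have "holonomy f w = ?i" using assms(4) by simp
  then show ?thesis using l by simp
qed


section \<open>Linked and unlinked pairs in a single word\<close>

text \<open>Take a pair \<open>x\<close>, \<open>prod.swap x\<close> with the shortest stretch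
  \<open>m\<close> in between. If \<open>m\<close> begins with \<open>y\<close>, the reversal of
  \<open>y\<close> lies either inside \<open>m\<close>, giving a shorter stretch, or outside,
  linking the two pairs.\<close>

lemma unlinked_adjacent_pair:
  assumes "distinct w" "prod.swap ` set w \<subseteq> set w"
      "\<forall>x\<in>set w. fst x \<noteq> snd x" "w \<noteq> []"
    and unlinked: "\<And>x y. \<not> subseq [x, y, prod.swap x, prod.swap y] w"
  shows "\<exists>a x b. w = a @ [x, prod.swap x] @ b"
proof -
  let ?P = "\<lambda>(a, x, m, b). w = a @ x # m @ prod.swap x # b"
  have sw: "x \<in> set w \<Longrightarrow> prod.swap x \<noteq> x" for x
    using assms(3) by (cases x) auto
  \<comment> \<open>The reversal of the first letter can only come later, so there is a candidate to
    minimize over.\<close>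
  obtain x t where w: "w = x # t" using assms(4) by (cases w) auto
  have "prod.swap x \<in> set w" using assms(2) w by auto
  then have "prod.swap x \<in> set t" using w sw by auto
  then obtain m b where "t = m @ prod.swap x # b" by (meson split_list)
  then have "?P ([], x, m, b)" by (simp add: w)
  from ex_has_least_nat[of ?P, OF this, of "\<lambda>(a, x, m, b). length m"]
  obtain q where q: "?P q"
    "\<forall>q'. ?P q' \<longrightarrow> (\<lambda>(a, x, m, b). length m) q \<le> (\<lambda>(a, x, m, b). length m) q'"
    by blast
  obtain a x m b where [simp]: "q = (a, x, m, b)" by (metis prod_cases4)
  have P: "w = a @ x # m @ prod.swap x # b" using q(1) by simp
  have least: "length m \<le> length m'" if "w = a' @ x' # m' @ prod.swap x' # b'" for a' x' m' b'
    using q(2)[rule_format, of "(a', x', m', b')"] that by simp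
  show ?thesis
  proof (cases m)
    case Nil
    then show ?thesis using P by (intro exI[of _ a] exI[of _ x] exI[of _ b]) simp
  next
    case (Cons y m')
    have "prod.swap y \<in> set w" using assms(2) P Cons by auto
    moreover have "y \<noteq> x" using assms(1) P Cons by auto
    then have "prod.swap y \<noteq> prod.swap x" by (metis swap_swap)
    moreover have "y \<noteq> prod.swap x" using assms(1) P Cons by auto
    then have "prod.swap y \<noteq> x" by (metis swap_swap)
    moreover have "prod.swap y \<noteq> y" using sw P Cons by auto
    ultimately consider "prod.swap y \<in> set a" | "prod.swap y \<in> set m'" |
        "prod.swap y \<in> set b"
      using P Cons by auto
    then show ?thesis
    proof cases
      \<comment> \<open>Here \<open>prod.swap y\<close> precedes \<open>x\<close> and takes the role
        of the first letter in the linked pattern.\<close>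
      case 1
      then obtain a1 a2 where "a = a1 @ prod.swap y # a2" by (meson split_list)
      then have w: "w = a1 @ ([prod.swap y] @ a2) @ ([x, y] @ m') @ ([prod.swap x] @ b)"
        using P Cons by simp
      have "subseq ([] @ [prod.swap y] @ [x, y] @ [prod.swap x]) w"
        unfolding w by (intro list_emb_append_mono) auto
      then show ?thesis using unlinked[of "prod.swap y" x] by simp
    next
      case 2
      then obtain p q where "m' = p @ prod.swap y # q" by (meson split_list)
      then have "w = (a @ [x]) @ y # p @ prod.swap y # (q @ prod.swap x # b)"
        using P Cons by simp
      from least[OF this] show ?thesis using Cons \<open>m' = p @ prod.swap y # q\<close> by simp
    next
      case 3
      then obtain p q where "b = p @ prod.swap y # q" by (meson split_list)
      then have w: "w = a @ ([x, y] @ m') @ ([prod.swap x] @ p) @ ([prod.swap y] @ q)"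
        using P Cons by simp
      have "subseq ([] @ [x, y] @ [prod.swap x] @ [prod.swap y]) w"
        unfolding w by (intro list_emb_append_mono) auto
      then show ?thesis using unlinked[of x y] by simp
    qed
  qed
qed

text \<open>
  An innermost edge pair bounds nothing and is adjacent; deleting it removes one edge and one
  vertex. So an unlinked word is a tree traversed around, with one more vertex than edges.
\<close>

lemma card_vertices_unlinked:
  assumes "scheme [w]" "one_orbit_per_vertex [w]" "w \<noteq> []"
    and "\<And>x y. \<not> subseq [x, y, prod.swap x, prod.swap y] w"
  shows "length w + 2 \<le> 2 * card (fst ` set w)"
  using assms
proof (induction w rule: length_induct)
  case (1 w)
  have dist: "distinct w" and sym: "prod.swap ` set w \<subseteq> set w"
    and irr: "\<forall>x\<in>set w. fst x \<noteq> snd x"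
    using "1.prems"(1) by (auto simp: scheme_def)
  obtain a x b where w: "w = a @ [x, prod.swap x] @ b"
    using unlinked_adjacent_pair[OF dist sym irr "1.prems"(3,4)] by blast
  have xx: "fst x \<noteq> snd x" using irr w by simp
  then have sx: "prod.swap x \<noteq> x" by (cases x) auto
  show ?case
  proof (cases "b @ a = []")
    \<comment> \<open>Two opposite edges on two vertices: the bound is attained.\<close>
    case True
    then show ?thesis using w xx by simp
  next
    case False
    let ?r = "b @ a" and ?w = "a @ b"
    have rot: "cyc_invariant S w \<longleftrightarrow> cyc_invariant S (x # prod.swap x # ?r)" for S
      using cyc_invariant_rotate[of S a "[x, prod.swap x] @ b"] w by simp
    have nr: "x \<notin> set ?r" "prod.swap x \<notin> set ?r" "set ?r = set ?w"
      using dist w by auto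
    have set_w: "set w = {x, prod.swap x} \<union> set ?r" using w by auto
    \<comment> \<open>The corner between \<open>x\<close> and \<open>prod.swap x\<close> only
      relates \<open>prod.swap x\<close> to itself, so \<open>prod.swap x\<close> is an orbit alone,
      while \<open>x\<close> sits between the reversal of \<open>last ?r\<close> and
      \<open>hd ?r\<close>.\<close>
    have inv: "cyc_invariant S w \<longleftrightarrow> (x \<in> S \<longleftrightarrow>
        hd ?r \<in> S) \<and> (prod.swap (last ?r) \<in> S \<longleftrightarrow> x \<in> S) \<and>
        (\<forall>(a, b)\<in>set (zip ?r (tl ?r)). prod.swap a \<in> S \<longleftrightarrow> b \<in> S)" for S
    proof -
      obtain y t where yt: "?r = y # t" using False by (cases ?r) auto
      show ?thesis unfolding rot yt
        by (auto simp: cyc_invariant_Cons simp del: last.simps) auto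
    qed
    have inv': "cyc_invariant S ?w \<longleftrightarrow>
        (prod.swap (last ?r) \<in> S \<longleftrightarrow> hd ?r \<in> S) \<and>
        (\<forall>(a, b)\<in>set (zip ?r (tl ?r)). prod.swap a \<in> S \<longleftrightarrow> b \<in> S)" for S
      using cyc_invariant_rotate[of S a b] cyc_invariant_nonempty[OF False] by simp
    have sw_ne: "y \<in> set ?r \<Longrightarrow> prod.swap y \<noteq> x \<and>
        prod.swap y \<noteq> prod.swap x" for y
      using nr by (metis swap_swap)
    have "scheme [?w]"
      using dist irr sym nr sw_ne unfolding scheme_def by (auto simp: w image_subset_iff)
    moreover have "one_orbit_per_vertex [?w]"
      unfolding one_orbit_per_vertex_def
    proof (intro allI impI ballI, goal_cases)
      case (1 S y z)
      \<comment> \<open>Membership of \<open>x\<close> is forced by its neighbour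
        \<open>hd ?r\<close>; that of \<open>prod.swap x\<close> is free.\<close>
      let ?S = "if hd ?r \<in> S then insert x S else S - {x}"
      have mem: "y \<noteq> x \<Longrightarrow> y \<in> ?S \<longleftrightarrow> y \<in> S" for y
          by simp
      have "cyc_invariant S ?w" using 1 by simp
      then have i: "prod.swap (last ?r) \<in> S \<longleftrightarrow> hd ?r \<in> S"
        "\<And>a b. (a, b)\<in>set (zip ?r (tl ?r)) \<Longrightarrow>
            prod.swap a \<in> S \<longleftrightarrow> b \<in> S"
        unfolding inv' by auto
      have l: "last ?r \<in> set ?r" "hd ?r \<in> set ?r" using False
          by (metis last_in_set, metis hd_in_set)
      have "cyc_invariant ?S w" unfolding inv
      proof (intro conjI ballI, goal_cases)
        case 1
        show ?case using mem[of "hd ?r"] l nr(1) by auto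
      next
        case 2
        show ?case using mem[of "prod.swap (last ?r)"] l i(1) sw_ne by auto
      next
        case (3 ab)
        obtain p q where [simp]: "ab = (p, q)" by (cases ab)
        have "p \<in> set ?r" "q \<in> set ?r" using 3 set_zip_tl[of p q ?r] by auto
        then show ?case using i(2)[of p q] mem[of "prod.swap p"] mem[of q] sw_ne nr(1) 3 by auto
      qed
      then have "y \<in> ?S \<longleftrightarrow> z \<in> ?S"
        using one_orbit_per_vertexD[OF "1.prems"(2), of ?S y z] 1 set_w nr by auto
      then show ?case using mem[of y] mem[of z] 1 nr by auto
    qed
    moreover have "\<not> subseq [y, z, prod.swap y, prod.swap z] ?w" for y z
    proof
      assume "subseq [y, z, prod.swap y, prod.swap z] ?w"
      moreover have "subseq ?w w" unfolding w
        by (intro list_emb_append_mono list_emb_append2) auto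
      ultimately show False using "1.prems"(4) subseq_order.trans by blast
    qed
    ultimately have IH: "length ?w + 2 \<le> 2 * card (fst ` set ?w)"
      using "1.IH"[rule_format, of ?w] False w by force
    \<comment> \<open>\<open>snd x\<close> is a leaf: the singleton of \<open>prod.swap x\<close> is
      invariant, so no other edge leaves this vertex, and deleting the pair removes it.\<close>
    have "snd x \<notin> fst ` set ?w"
    proof
      assume "snd x \<in> fst ` set ?w"
      then obtain y where "y \<in> set ?r" "snd x = fst y" unfolding nr(3) by (rule imageE)
      then have y: "y \<in> set ?r" "fst y = fst (prod.swap x)" by (simp_all only: fst_swap)
      have "cyc_invariant {prod.swap x} w"
        unfolding inv
      proof (intro conjI ballI, goal_cases)
        case 1
        have "hd ?r \<noteq> prod.swap x" using nr(2) hd_in_set[OF False] by metis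
        then show ?case using sx by (metis singletonD)
      next
        case 2
        show ?case using sx sw_ne[OF last_in_set[OF False]] by (metis singletonD)
      next
        case (3 pq)
        obtain p q where [simp]: "pq = (p, q)" by (cases pq)
        have "p \<in> set ?r" "q \<in> set ?r" using 3 set_zip_tl[of p q ?r] by auto
        then have "prod.swap p \<noteq> prod.swap x" "q \<noteq> prod.swap x"
            using sw_ne[of p] nr(2) by auto
        then show ?case by (simp only: \<open>pq = (p, q)\<close> prod.case singleton_iff)
      qed
      then have "y \<in> {prod.swap x} \<longleftrightarrow> prod.swap x \<in> {prod.swap x}"
        using y(1,2) set_w by (intro one_orbit_per_vertexD[OF
            "1.prems"(2)]) (simp_all del: set_append)
      then show False using y(1) nr(2) by (metis singletonD singletonI)
    qed
    moreover have "insert (snd x) (fst ` set ?w) \<subseteq> fst ` set w"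
      using set_w by force
    ultimately have "card (fst ` set ?w) + 1 \<le> card (fst ` set w)"
      by (metis List.finite_set Suc_eq_plus1 card_insert_disjoint card_mono finite_imageI)
    then show ?thesis using IH w by simp
  qed
qed

lemma linked_labelling:
  assumes "scheme [w]" and linked: "subseq [x, y, prod.swap x, prod.swap y] w"
    and units: "u * u' = 1" "u' * u = 1" "v * v' = 1" "v' * v = (1::'g::monoid_mult)"
    and noncomm: "u * v \<noteq> v * u"
  shows "\<exists>f. edge_labelling (set w) f \<and> holonomy f w \<noteq> (1::'g)"
proof -
  let ?l = "[x, y, prod.swap x, prod.swap y]"
  let ?f = "(\<lambda>_. 1)(x := u, prod.swap x := u', y := v, prod.swap y := v')"
  have dist: "distinct w" and irr: "\<forall>x\<in>set w. fst x \<noteq> snd x"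
    using assms(1) by (auto simp: scheme_def)
  have dl: "distinct ?l" using linked dist
      by (auto simp only: subseq_conv_nths intro: distinct_nthsI)
  then have ne: "x \<noteq> y" "prod.swap x \<noteq> x" "prod.swap y \<noteq> x"
      "prod.swap x \<noteq> y" "prod.swap y \<noteq> y"
     "prod.swap x \<noteq> prod.swap y"
    by auto
  \<comment> \<open>The letters of \<open>w\<close> that belong to \<open>?l\<close> contain
    \<open>?l\<close> as a subsequence, and there are at most four of them since \<open>w\<close> is
    distinct; hence they are exactly \<open>?l\<close>, in this order.\<close>
  have "subseq (filter (\<lambda>z. z \<in> set ?l) ?l) (filter (\<lambda>z. z \<in> set ?l) w)"
    by (rule subseq_filter[OF linked])
  moreover have "filter (\<lambda>z. z \<in> set ?l) ?l = ?l" by simp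
  moreover have "length (filter (\<lambda>z. z \<in> set ?l) w) \<le> length ?l"
  proof -
    have "length (filter (\<lambda>z. z \<in> set ?l) w) =
        card (set (filter (\<lambda>z. z \<in> set ?l) w))"
      using dist by (metis distinct_card distinct_filter)
    also have "\<dots> \<le> card (set ?l)" by (intro card_mono) auto
    also have "\<dots> \<le> length ?l" by (rule card_length)
    finally show ?thesis .
  qed
  ultimately have filter: "filter (\<lambda>z. z \<in> set ?l) w = ?l"
    by (metis list_emb_length le_antisym subseq_same_length)
  have drop: "holonomy f w = holonomy f (filter P w)" if "\<And>z. \<not> P z \<Longrightarrow>
      f z = 1"
    for f :: "'a \<times> 'a \<Rightarrow> 'g" and P w
    using that by (induction w) auto
  have "holonomy ?f w = holonomy ?f ?l"
    using drop[of "\<lambda>z. z \<in> set ?l" ?f w] unfolding filter by simp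
  also have "\<dots> = u * (v * (u' * v'))"
    using ne by simp
  \<comment> \<open>If the commutator were \<open>1\<close>, multiplying by \<open>v * u\<close> on
    the right would give \<open>u * v = v * u\<close>.\<close>
  also have "\<dots> \<noteq> 1"
  proof
    assume "u * (v * (u' * v')) = 1"
    then have "u * (v * (u' * v')) * (v * u) = v * u" by simp
    then have "u * v * (u' * (v' * v) * u) = v * u" by (simp add: mult.assoc)
    then show False using units noncomm by simp
  qed
  finally have "holonomy ?f w \<noteq> 1" .
  moreover have "edge_labelling (set w) ?f"
    unfolding edge_labelling_def
  proof
    fix z :: "'a \<times> 'a"
    have sw: "prod.swap z = a \<longleftrightarrow> z = prod.swap a" for a by (metis swap_swap)
    show "?f z * ?f (prod.swap z) = 1"
      using ne ne[symmetric] units unfolding fun_upd_apply sw by (auto simp del: swap_simp)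
  qed
  ultimately show ?thesis by blast
qed

section \<open>Reduction of a scheme to a single word\<close>

text \<open>
  Gluing two words along the edge \<open>d\<close>. A labelling of the glued scheme extends uniquely over \<open>d\<close>
  so that the absorbed word becomes flat, and then the first word keeps its holonomy.
\<close>

lemma glue_scheme:
  assumes "scheme ((x @ d # y) # ws1 @ (a @ prod.swap d # b) # ws2)"
  shows "scheme ((x @ b @ a @ y) # ws1 @ ws2)"
    and "set (concat ((x @ d # y) # ws1 @ (a @ prod.swap d # b) # ws2)) =
      insert d (insert (prod.swap d) (set (concat ((x @ b @ a @ y) # ws1 @ ws2))))"
    and "d \<notin> set (concat ((x @ b @ a @ y) # ws1 @ ws2))"
    and "prod.swap d \<notin> set (concat ((x @ b @ a @ y) # ws1 @ ws2))"
    and "prod.swap d \<noteq> d"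
proof -
  let ?D = "set (concat ((x @ d # y) # ws1 @ (a @ prod.swap d # b) # ws2))"
  let ?D' = "set (concat ((x @ b @ a @ y) # ws1 @ ws2))"
  show D: "?D = insert d (insert (prod.swap d) ?D')" by auto
  have dist: "distinct (concat ((x @ d # y) # ws1 @ (a @ prod.swap d # b) # ws2))"
    by (rule schemeD[OF assms])
  show d: "d \<notin> ?D'" "prod.swap d \<notin> ?D'" using dist by auto
  show "prod.swap d \<noteq> d" using dist by auto
  have "prod.swap e \<in> ?D'" if "e \<in> ?D'" for e
  proof -
    have "prod.swap ` ?D \<subseteq> ?D" by (rule schemeD[OF assms])
    moreover have "e \<in> ?D" using that unfolding D by blast
    ultimately have "prod.swap e \<in> ?D" by blast
    moreover have "e \<noteq> d" "e \<noteq> prod.swap d" using d that by metis+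
    then have "prod.swap e \<noteq> prod.swap d" "prod.swap e \<noteq> d" by (metis swap_swap)+
    ultimately show ?thesis unfolding D by blast
  qed
  moreover have "distinct (concat ((x @ b @ a @ y) # ws1 @ ws2))"
  proof -
    let ?w = "concat ((x @ b @ a @ y) # ws1 @ ws2)"
    \<comment> \<open>The old letters are the glued ones together with \<open>d\<close> and its
      reversal, and distinctness depends only on the multiset.\<close>
    have "mset (concat ((x @ d # y) # ws1 @ (a @ prod.swap d # b) # ws2)) =
        mset (d # prod.swap d # ?w)"
      by simp
    from mset_eq_imp_distinct_iff[OF this] dist have "distinct (d # prod.swap d # ?w)" by blast
    then show ?thesis by (simp only: distinct.simps)
  qed
  moreover have "\<forall>e\<in>?D. fst e \<noteq> snd e" using schemeD(3)[OF assms] by blast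
  then have "\<forall>e\<in>?D'. fst e \<noteq> snd e" unfolding D by blast
  ultimately show "scheme ((x @ b @ a @ y) # ws1 @ ws2)"
    unfolding scheme_def by blast
qed

text \<open>An invariant set of the glued scheme extends to the old one: in the old rotation
  \<open>d\<close> is next to \<open>hd (b @ a)\<close> and \<open>prod.swap d\<close> next to
  \<open>hd (y @ x)\<close>, which dictates their membership. Nonemptiness guarantees that these
  neighbours survive the gluing.\<close>

lemma glue_orbits:
  assumes scheme: "scheme ((x @ d # y) # ws1 @ (a @ prod.swap d # b) # ws2)"
    and "one_orbit_per_vertex ((x @ d # y) # ws1 @ (a @ prod.swap d # b) # ws2)"
    and ne: "y @ x \<noteq> []" "b @ a \<noteq> []"
  shows "one_orbit_per_vertex ((x @ b @ a @ y) # ws1 @ ws2)"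
  unfolding one_orbit_per_vertex_def
proof (intro allI impI ballI, goal_cases)
  case (1 S e e')
  let ?D' = "set (concat ((x @ b @ a @ y) # ws1 @ ws2))"
  let ?S0 = "if hd (b @ a) \<in> S then insert d S else S - {d}"
  let ?S = "if hd (y @ x) \<in> S then insert (prod.swap d) ?S0 else ?S0 - {prod.swap d}"
  note g = glue_scheme[OF scheme]
  have mem: "f \<in> ?S \<longleftrightarrow> f \<in> S" if "f \<in> ?D'" for f using that g by auto
  have mem': "prod.swap f \<in> ?S \<longleftrightarrow> prod.swap f \<in> S" if "f \<in> ?D'" for f
  proof -
    have "prod.swap f \<in> ?D'" using that schemeD(2)[OF g(1)] by blast
    then show ?thesis by (rule mem)
  qed
  have d: "d \<in> ?S \<longleftrightarrow> hd (b @ a) \<in> S"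
      "prod.swap d \<in> ?S \<longleftrightarrow> hd (y @ x) \<in> S"
    using g(5) by auto
  have invD: "cyc_invariant ?S w \<longleftrightarrow> cyc_invariant S w" if "set w \<subseteq> ?D'"
      for w
  proof -
    have "(prod.swap p \<in> ?S \<longleftrightarrow> q \<in> ?S) \<longleftrightarrow>
        (prod.swap p \<in> S \<longleftrightarrow> q \<in> S)" if "(p, q) \<in> set (zip w (rotate1 w))" for p q
    proof -
      have "p \<in> ?D'" "q \<in> ?D'"
        using \<open>set w \<subseteq> ?D'\<close> set_zip_leftD[OF that] set_zip_rightD[OF that]
            by (simp_all only: set_rotate1) blast+
      then show ?thesis using mem mem' by blast
    qed
    then show ?thesis unfolding cyc_invariant_def by blast
  qed
  have zips: "(\<forall>(p, q)\<in>set (zip w (tl w)). prod.swap p \<in> ?S \<longleftrightarrow>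
      q \<in> ?S) \<longleftrightarrow>
     (\<forall>(p, q)\<in>set (zip w (tl w)). prod.swap p \<in> S \<longleftrightarrow> q \<in> S)" if "set w \<subseteq> ?D'" for w
  proof -
    have "(prod.swap p \<in> ?S \<longleftrightarrow> q \<in> ?S) \<longleftrightarrow>
        (prod.swap p \<in> S \<longleftrightarrow> q \<in> S)" if "(p, q) \<in> set (zip w (tl w))" for p q
    proof -
      have "p \<in> ?D'" "q \<in> ?D'"
        using set_zip_tl[OF that] \<open>set w \<subseteq> ?D'\<close> by blast+
      then show ?thesis using mem mem' by blast
    qed
    then show ?thesis by blast
  qed
  have sub: "set (y @ x) \<subseteq> ?D'" "set (b @ a) \<subseteq> ?D'" by auto
  have in_D': "hd (y @ x) \<in> ?D'" "last (y @ x) \<in> ?D'" "hd (b @ a) \<in> ?D'"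
      "last (b @ a) \<in> ?D'"
    using sub hd_in_set[OF ne(1)] hd_in_set[OF ne(2)] last_in_set[OF ne(1)] last_in_set[OF ne(2)]
        by blast+
  \<comment> \<open>The two seams of the glued word are the corners at the two ends of the erased
    edge.\<close>
  have "cyc_invariant S (x @ b @ a @ y)" using 1 by simp
  then have "cyc_invariant S ((b @ a) @ (y @ x))" using cyc_invariant_rotate[of S x "b @ a @ y"]
      by simp
  then have i: "prod.swap (last (b @ a)) \<in> S \<longleftrightarrow> hd (y @ x) \<in> S"
      "prod.swap (last (y @ x)) \<in> S \<longleftrightarrow> hd (b @ a) \<in> S"
      "\<forall>(p, q)\<in>set (zip (b @ a) (tl (b @ a))). prod.swap p \<in> S \<longleftrightarrow>
          q \<in> S"
      "\<forall>(p, q)\<in>set (zip (y @ x) (tl (y @ x))). prod.swap p \<in> S \<longleftrightarrow>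
          q \<in> S"
    unfolding cyc_invariant_append[OF ne(2,1)] by blast+
  have "cyc_invariant ?S (d # (y @ x))"
    unfolding cyc_invariant_Cons[OF ne(1)] zips[OF sub(1)] d mem[OF in_D'(1)] mem'[OF in_D'(2)]
    using i by blast
  then have I1: "cyc_invariant ?S (x @ d # y)" using cyc_invariant_rotate[of ?S x "d # y"] by simp
  have "cyc_invariant ?S (prod.swap d # (b @ a))"
    unfolding cyc_invariant_Cons[OF ne(2)] zips[OF sub(2)] d swap_swap mem[OF in_D'(3)] mem'[OF in_D'(4)]
    using i by blast
  then have I2: "cyc_invariant ?S (a @ prod.swap d # b)"
    using cyc_invariant_rotate[of ?S a "prod.swap d # b"] by simp
  have I3: "cyc_invariant ?S w" if "w \<in> set (ws1 @ ws2)" for w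
  proof -
    have "set w \<subseteq> ?D'" using that by auto
    then show ?thesis using invD[of w] 1(1) that by auto
  qed
  have "e \<in> ?S \<longleftrightarrow> e' \<in> ?S"
  proof (rule one_orbit_per_vertexD[OF assms(2)])
    fix w assume "w \<in> set ((x @ d # y) # ws1 @ (a @ prod.swap d # b) # ws2)"
    then consider "w = x @ d # y" | "w = a @ prod.swap d # b" | "w \<in> set (ws1 @ ws2)" by auto
    then show "cyc_invariant ?S w" by cases (use I1 I2 I3 in blast)+
  qed (use 1 g(2) in auto)
  then show ?case using mem 1 by blast
qed

text \<open>A family closed under reversal either contains the glued word, and then lifts by putting
  both old words in its place, or omits it, and then is closed already in the old scheme without
  being all of it.\<close>

lemma glue_connected:
  assumes scheme: "scheme ((x @ d # y) # ws1 @ (a @ prod.swap d # b) # ws2)"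
    and conn: "gluing_connected ((x @ d # y) # ws1 @ (a @ prod.swap d # b) # ws2)"
  shows "gluing_connected ((x @ b @ a @ y) # ws1 @ ws2)"
  unfolding gluing_connected_def
proof (intro allI impI, goal_cases)
  case (1 K)
  let ?P = "x @ d # y" and ?Q = "a @ prod.swap d # b" and ?w = "x @ b @ a @ y"
  let ?Ws = "?P # ws1 @ ?Q # ws2"
  have "distinct (concat ?Ws)" by (rule schemeD[OF scheme])
  then have disj: "?P \<notin> set (ws1 @ ws2)" "?Q \<notin> set (ws1 @ ws2)" by fastforce+
  show ?case
  proof (cases "?w \<in> K")
    case True
    let ?K = "insert ?P (insert ?Q (K - {?w}))"
    have UK: "(\<Union>w\<in>K. set w) = set ?w \<union> (\<Union>w\<in>K-{?w}. set w)" using True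
        by blast
    have UK': "(\<Union>w\<in>?K. set w) = insert d (insert (prod.swap d) (\<Union>w\<in>K. set w))"
      unfolding UK by auto
    have "prod.swap ` (\<Union>w\<in>?K. set w) \<subseteq> (\<Union>w\<in>?K. set w)"
    proof -
      have "insert p (insert q A) \<subseteq> insert q (insert p C)" if "A \<subseteq> C"
        for p q :: "'a \<times> 'a" and A C using that by blast
      from this[OF 1(3)] show ?thesis unfolding UK' unfolding image_insert[of prod.swap] swap_swap .
    qed
    moreover have "?K \<subseteq> set ?Ws" "?K \<noteq> {}" using 1(1) by auto
    ultimately have K: "?K = set ?Ws" by (intro gluing_connectedD[OF conn])
    have "set (ws1 @ ws2) \<subseteq> K"
    proof
      fix v assume v: "v \<in> set (ws1 @ ws2)"
      then have "v \<in> ?K" unfolding K by auto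
      moreover have "v \<noteq> ?P" "v \<noteq> ?Q" using v disj by blast+
      ultimately show "v \<in> K" by blast
    qed
    then show ?thesis using 1(1) True by auto
  next
    case False
    then have "K \<subseteq> set (ws1 @ ws2)" using 1(1) by auto
    moreover from this have "K \<subseteq> set ?Ws" by auto
    then have "K = set ?Ws" using 1(2,3) by (intro gluing_connectedD[OF conn])
    ultimately show ?thesis using disj by auto
  qed
qed

lemma glue_labelling:
  fixes f :: "'v \<times> 'v \<Rightarrow> 'g::monoid_mult"
  assumes scheme: "scheme ((x @ d # y) # ws1 @ (a @ prod.swap d # b) # ws2)"
    and f: "edge_labelling (set (concat ((x @ b @ a @ y) # ws1 @ ws2))) f"
    and flat: "\<And>w. w \<in> set (ws1 @ ws2) \<Longrightarrow> holonomy f w = 1"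
  shows "\<exists>f'. edge_labelling (set (concat ((x @ d # y) # ws1 @ (a @ prod.swap d # b) # ws2))) f' \<and>
    (\<forall>w\<in>set (ws1 @ (a @ prod.swap d # b) # ws2). holonomy f' w = 1) \<and>
    holonomy f' (x @ d # y) = holonomy f (x @ b @ a @ y)"
proof -
  let ?D' = "set (concat ((x @ b @ a @ y) # ws1 @ ws2))"
  let ?D = "set (concat ((x @ d # y) # ws1 @ (a @ prod.swap d # b) # ws2))"
  \<comment> \<open>Read from \<open>prod.swap d\<close>, the absorbed word is
    \<open>prod.swap d\<close> followed by \<open>b @ a\<close>; it is flat exactly if
    \<open>d\<close> carries the holonomy of \<open>b @ a\<close>.\<close>
  let ?f = "f(d := holonomy f (b @ a), prod.swap d := holonomy (\<lambda>e. f (prod.swap e)) (rev (b @ a)))"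
  note g = glue_scheme[OF scheme]
  have sub: "set (b @ a) \<subseteq> ?D'" by auto
  have sw: "prod.swap ` ?D' \<subseteq> ?D'" by (rule schemeD[OF g(1)])
  have sw_ne: "e \<in> ?D' \<Longrightarrow> prod.swap e \<noteq> d \<and>
      prod.swap e \<noteq> prod.swap d" for e
    using g(3,4) by (metis swap_swap)
  have fe: "?f e = f e" if "e \<in> ?D'" for e using that g by auto
  have same: "holonomy ?f w = holonomy f w" if "set w \<subseteq> ?D'" for w
    by (rule holonomy_cong, rule fe) (use that in blast)
  have L: "edge_labelling ?D ?f" unfolding edge_labelling_def g(2)
  proof (intro ballI, elim insertE)
    fix e assume "e = d"
    then show "?f e * ?f (prod.swap e) = 1" using holonomy_inverse[OF f sub] g(5) by auto
  next
    fix e assume "e = prod.swap d"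
    then show "?f e * ?f (prod.swap e) = 1" using holonomy_inverse'[OF f sub sw] g(5) by auto
  next
    fix e assume e: "e \<in> ?D'"
    then have "e \<noteq> d" "e \<noteq> prod.swap d" using g by auto
    then have "?f e * ?f (prod.swap e) = f e * f (prod.swap e)" using sw_ne[OF e] by simp
    then show "?f e * ?f (prod.swap e) = 1" using f e unfolding edge_labelling_def by metis
  qed
  have N: "holonomy ?f (a @ prod.swap d # b) = 1"
  proof -
    have "holonomy f a * holonomy (\<lambda>e. f (prod.swap e)) (rev (b @ a)) * holonomy f b =
      (holonomy f a * holonomy (\<lambda>e. f (prod.swap e)) (rev a)) *
       (holonomy (\<lambda>e. f (prod.swap e)) (rev b) * holonomy f b)"
      by (simp add: mult.assoc)
    also have "\<dots> = 1"
      using holonomy_inverse[OF f, of a] holonomy_inverse'[OF f, of b] sub sw by simp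
    finally show ?thesis using same[of a] same[of b] sub by (simp add: mult.assoc)
  qed
  have H: "holonomy ?f (x @ d # y) = holonomy f (x @ b @ a @ y)"
  proof -
    have "set x \<subseteq> ?D'" "set y \<subseteq> ?D'" by auto
    then show ?thesis using same[of x] same[of y] g(5) by (simp add: mult.assoc)
  qed
  have R: "holonomy ?f w = 1" if "w \<in> set (ws1 @ ws2)" for w
  proof -
    have "set w \<subseteq> ?D'" using that by auto
    then show ?thesis using same[of w] flat[OF that] by (simp only:)
  qed
  show ?thesis
  proof (intro exI[of _ ?f] conjI ballI)
    fix w assume "w \<in> set (ws1 @ (a @ prod.swap d # b) # ws2)"
    then have "w = a @ prod.swap d # b \<or> w \<in> set (ws1 @ ws2)" by auto
    then show "holonomy ?f w = 1" using N R by blast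
  qed (fact L, fact H)
qed

text \<open>The word lengths add up to twice the number of edges, so the numerical hypothesis says
  \<chi> \<le> 1. A gluing lowers its right side by 2 and its left side by at least 2, so it
  persists to the last polygon, where an unlinked word would have \<chi> \<ge> 2. Length at least
  two keeps what remains of both words nonempty in every gluing.\<close>

lemma nonflat_labelling:
  fixes u v :: "'g::monoid_mult"
  assumes "scheme (w0 # ws)" "one_orbit_per_vertex (w0 # ws)" "gluing_connected (w0 # ws)"
    and "\<forall>w\<in>set (w0 # ws). 2 \<le> length w"
    and "2 * card (fst ` set (concat (w0 # ws))) + 2 * length (w0 # ws) \<le> length (concat (w0 # ws)) + 2"
    and units: "u * u' = 1" "u' * u = 1" "v * v' = 1" "v' * v = 1"
    and noncomm: "u * v \<noteq> v * u"
  shows "\<exists>f. edge_labelling (set (concat (w0 # ws))) f \<and>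
      (\<forall>w\<in>set ws. holonomy f w = 1) \<and>
    holonomy f w0 \<noteq> (1::'g)"
  using assms(1-5)
proof (induction ws arbitrary: w0 rule: length_induct)
  case (1 ws)
  show ?case
  proof (cases "ws = []")
    case True
    have "\<exists>x y. subseq [x, y, prod.swap x, prod.swap y] w0"
    proof (rule ccontr)
      assume "\<not> ?thesis"
      then have "length w0 + 2 \<le> 2 * card (fst ` set w0)"
        using "1.prems" True by (intro card_vertices_unlinked) auto
      then show False using "1.prems"(5) True by simp
    qed
    then show ?thesis using linked_labelling[OF _ _ units noncomm, of w0] "1.prems"(1) True by auto
  next
    case False
    then obtain w1 ws' where ws: "ws = w1 # ws'" by (cases ws) auto
    have dist: "distinct (concat (w0 # ws))" and sw:
        "prod.swap ` set (concat (w0 # ws)) \<subseteq> set (concat (w0 # ws))"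
      using schemeD[OF "1.prems"(1)] by blast+
    \<comment> \<open>Nonempty words without common letters differ, so \<open>w0\<close> is not the
      only word, and connectedness yields a side of \<open>w0\<close> whose reversal lies in another
      one.\<close>
    have "w1 \<noteq> []" using "1.prems"(4) ws by auto
    then have "w1 \<noteq> w0" using dist ws by auto
    then have "{w0} \<noteq> set (w0 # ws)" using ws by auto
    then have "\<not> prod.swap ` set w0 \<subseteq> set w0"
      using gluing_connectedD[OF "1.prems"(3), of "{w0}"] by auto
    then obtain d where d: "d \<in> set w0" "prod.swap d \<notin> set w0" by blast
    then obtain w where w: "w \<in> set ws" "prod.swap d \<in> set w" using sw by auto
    obtain x y where w0: "w0 = x @ d # y" using d by (meson split_list)
    obtain a b where wab: "w = a @ prod.swap d # b" using w by (meson split_list)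
    obtain ws1 ws2 where ws12: "ws = ws1 @ w # ws2" using w by (meson split_list)
    let ?w = "x @ b @ a @ y"
    note scheme = "1.prems"(1)[unfolded w0 wab ws12]
    note g = glue_scheme[OF scheme]
    have len: "2 \<le> length w0" "2 \<le> length w" using "1.prems"(4) w by auto
    have ne: "y @ x \<noteq> []" "b @ a \<noteq> []" using len unfolding w0 wab by auto
    have "\<exists>f. edge_labelling (set (concat (?w # ws1 @ ws2))) f \<and>
        (\<forall>w\<in>set (ws1 @ ws2). holonomy f w = 1) \<and>
        holonomy f ?w \<noteq> (1::'g)"
    proof (rule "1.IH"[rule_format])
      show "length (ws1 @ ws2) < length ws" using ws12 by simp
      show "scheme (?w # ws1 @ ws2)" by (rule g)
      show "one_orbit_per_vertex (?w # ws1 @ ws2)"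
        by (rule glue_orbits[OF scheme _ ne]) (use
            "1.prems"(2) in \<open>unfold w0 wab ws12\<close>)
      show "gluing_connected (?w # ws1 @ ws2)"
        by (rule glue_connected[OF scheme]) (use "1.prems"(3) in \<open>unfold w0 wab ws12\<close>)
      show "2 \<le> length v" if "v \<in> set (?w # ws1 @ ws2)" for v
        using that "1.prems"(4) len unfolding ws12 w0 wab by auto
      have "card (fst ` set (concat (?w # ws1 @ ws2))) \<le> card (fst ` set (concat (w0 # ws)))"
        by (intro card_mono) (auto simp: w0 wab ws12)
      then show "2 * card (fst ` set (concat (?w # ws1 @ ws2))) + 2 * length (?w # ws1 @ ws2)
        \<le> length (concat (?w # ws1 @ ws2)) + 2"
        using "1.prems"(5) unfolding ws12 w0 wab by simp
    qed
    then obtain f where f: "edge_labelling (set (concat (?w # ws1 @ ws2))) f"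
      "\<And>w. w \<in> set (ws1 @ ws2) \<Longrightarrow> holonomy f w = 1"
          "holonomy f ?w \<noteq> (1::'g)" by blast
    obtain f' where f':
      "edge_labelling (set (concat ((x @ d # y) # ws1 @ (a @ prod.swap d # b) # ws2))) f'"
      "\<forall>w\<in>set (ws1 @ (a @ prod.swap d # b) # ws2). holonomy f' w = 1"
      "holonomy f' (x @ d # y) = holonomy f ?w"
      using glue_labelling[OF scheme f(1,2)] by blast
    have "holonomy f' (x @ d # y) \<noteq> 1" using f(3) unfolding f'(3) .
    with f'(1,2) show ?thesis unfolding w0 wab ws12 by blast
  qed
qed

section \<open>Topology of subdivided surfaces\<close>

lemma surface_chart:
  assumes "closed_surface X" "p \<in> topspace X"
  obtains U \<phi> and \<psi> :: "real ^ 2 \<Rightarrow> 'a" where "openin X U" "p \<in> U"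
    "continuous_map (subtopology X U) euclidean \<phi>" "continuous_map euclidean X \<psi>"
    "\<And>x. x \<in> U \<Longrightarrow> \<psi> (\<phi> x) = x" "\<And>y. \<psi> y \<in> U"
        "\<And>y. \<phi> (\<psi> y) = y"
proof -
  obtain U where U: "openin X U" "p \<in> U"
    "subtopology X U homeomorphic_space (euclidean :: (real ^ 2) topology)"
    using assms unfolding closed_surface_def by blast
  then obtain \<phi> and \<psi> :: "real ^ 2 \<Rightarrow> 'a" where h:
      "homeomorphic_maps (subtopology X U) euclidean \<phi> \<psi>"
    unfolding homeomorphic_space_def by blast
  have "topspace (subtopology X U) = U" using openin_subset[OF U(1)] by auto
  with h U show thesis
    by (intro that[of U \<phi> \<psi>]) (auto simp: homeomorphic_maps_def continuous_map_in_subtopology)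
qed

text \<open>Around each point a chart turns \<open>f\<close> into an injective continuous map from
  an open set of the plane to the plane, where invariance of domain applies.\<close>

lemma open_image_surface:
  fixes f :: "'a \<Rightarrow> complex"
  assumes "closed_surface X" "openin X N" "continuous_map (subtopology X N) euclidean f"
      "inj_on f N"
  shows "open (f ` N)"
proof (subst openin_subopen[of euclidean, unfolded open_openin[symmetric]], intro ballI)
  fix y assume "y \<in> f ` N"
  then obtain p where p: "p \<in> N" "y = f p" by blast
  then have "p \<in> topspace X" using openin_subset[OF assms(2)] by blast
  with assms(1) obtain U \<phi> and \<psi> :: "real ^ 2 \<Rightarrow> 'a" where U: "openin X U"
      "p \<in> U"
    "continuous_map (subtopology X U) euclidean \<phi>" "continuous_map euclidean X \<psi>"
    "\<And>x. x \<in> U \<Longrightarrow> \<psi> (\<phi> x) = x" "\<And>y. \<psi> y \<in> U"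
        "\<And>y. \<phi> (\<psi> y) = y"
    by (rule surface_chart) blast
  let ?T = "{y. \<psi> y \<in> N}"
  have "openin euclidean {y \<in> topspace euclidean. \<psi> y \<in> N}"
    by (rule openin_continuous_map_preimage[OF U(4) assms(2)])
  then have T: "open ?T" by simp
  have "continuous_map (top_of_set ?T) (subtopology X N) \<psi>"
    using U(4) by (auto simp: continuous_map_in_subtopology continuous_map_from_subtopology)
  from continuous_map_compose[OF this assms(3)] have "continuous_on ?T (f \<circ> \<psi>)" by simp
  moreover have "inj_on (f \<circ> \<psi>) ?T"
    using assms(4) U(7) by (auto simp: inj_on_def) metis
  ultimately have "open ((f \<circ> \<psi>) ` ?T)"
    using T by (intro invariance_of_domain_gen) auto
  moreover have "y \<in> (f \<circ> \<psi>) ` ?T" using p U by (auto intro!: image_eqI[of _ _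
      "\<phi> p"])
  moreover have "(f \<circ> \<psi>) ` ?T \<subseteq> f ` N" by auto
  ultimately show "\<exists>T. open T \<and> y \<in> T \<and> T \<subseteq> f ` N" by blast
qed

text \<open>A punctured disc is connected, so a surface has no pinch points.\<close>

lemma no_pinch_point:
  assumes "closed_surface X" "openin X N" "p \<in> N" "closedin X A" "closedin X C"
    and cover: "N \<subseteq> A \<union> C" and meet: "N \<inter> A \<inter> C \<subseteq> {p}"
    and limit: "p \<in> X derived_set_of A" "p \<in> X derived_set_of C"
  shows False
proof -
  have "p \<in> topspace X" using openin_subset[OF assms(2)] assms(3) by blast
  with assms(1) obtain U \<phi> and \<psi> :: "real ^ 2 \<Rightarrow> 'a" where U: "openin X U"
      "p \<in> U"
    "continuous_map (subtopology X U) euclidean \<phi>" "continuous_map euclidean X \<psi>"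
    "\<And>x. x \<in> U \<Longrightarrow> \<psi> (\<phi> x) = x" "\<And>y. \<psi> y \<in> U"
        "\<And>y. \<phi> (\<psi> y) = y"
    by (rule surface_chart) blast
  have "openin euclidean {y \<in> topspace euclidean. \<psi> y \<in> N}"
    by (rule openin_continuous_map_preimage[OF U(4) assms(2)])
  then have "open {y. \<psi> y \<in> N}" by simp
  moreover have "\<phi> p \<in> {y. \<psi> y \<in> N}" using U assms(3) by simp
  ultimately obtain r where r: "r > 0" "ball (\<phi> p) r \<subseteq> {y. \<psi> y \<in> N}"
    unfolding open_contains_ball by blast
  let ?S = "ball (\<phi> p) r - {\<phi> p}"
  have conn: "connected ?S" by (rule connected_punctured_ball) simp
  have closed: "closed {y. \<psi> y \<in> K}" if "closedin X K" for K
    using closedin_continuous_map_preimage[OF U(4) that] by simp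
  let ?O = "{x \<in> U. \<phi> x \<in> ball (\<phi> p) r}"
  have "topspace (subtopology X U) = U" using openin_subset[OF U(1)] by auto
  with openin_continuous_map_preimage[OF U(3), of "ball (\<phi> p) r"]
  have "openin (subtopology X U) ?O" by (simp only: open_openin[symmetric] open_ball)
  then have O: "openin X ?O" using U(1) openin_open_subtopology by blast
  \<comment> \<open>A limit point of \<open>K\<close> has points of \<open>K\<close> other than
    itself nearby, so \<open>K\<close> leaves a trace in the punctured ball.\<close>
  have ne: "{y. \<psi> y \<in> K} \<inter> ?S \<noteq> {}" if "p \<in> X derived_set_of K" for K
  proof -
    have "p \<in> ?O" using U(2) r(1) by simp
    from in_derived_set_of[THEN iffD1, OF that, THEN conjunct2, rule_format, OF conjI[OF this O]]
    obtain x where x: "x \<noteq> p" "x \<in> K" "x \<in> ?O" by (elim exE conjE)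
    then have "\<phi> x \<noteq> \<phi> p" using U(2,5)
        by (metis (mono_tags, lifting) mem_Collect_eq)
    then have "\<phi> x \<in> {y. \<psi> y \<in> K} \<inter> ?S" using x U(5) by auto
    then show ?thesis by blast
  qed
  have "?S \<subseteq> {y. \<psi> y \<in> A} \<union> {y. \<psi> y \<in> C}" using r(2) cover
      by blast
  moreover have "{y. \<psi> y \<in> A} \<inter> {y. \<psi> y \<in> C} \<inter> ?S = {}"
  proof -
    have "y = \<phi> p" if "\<psi> y \<in> A" "\<psi> y \<in> C" "y \<in> ball (\<phi> p) r" for y
    proof -
      have "\<psi> y = p" using that r(2) meet by blast
      then show ?thesis using U(7) by metis
    qed
    then show ?thesis by blast
  qed
  ultimately show False
    using conn closed[OF assms(4)] closed[OF assms(5)] ne[OF limit(1)] ne[OF limit(2)]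
    unfolding connected_closed by blast
qed

section \<open>Model polygons and edge arcs\<close>

lemma corner_mod:
  assumes "k > 0"
  shows "corner k (j mod k) = corner k j"
proof -
  have "2 * pi * real j / real k = 2 * pi * real (j mod k) / real k + 2 * pi * real (j div k)"
  proof -
    have "real j = real (j mod k) + real k * real (j div k)"
      by (metis mod_mult_div_eq of_nat_add of_nat_mult)
    then show ?thesis using assms by (simp add: field_simps)
  qed
  moreover have "cis (2 * pi * real (j div k)) = 1"
    by (rule cis_multiple_2pi) auto
  ultimately show ?thesis unfolding corner_def by (simp flip: cis_mult)
qed

lemma inj_on_corner: "k > 0 \<Longrightarrow> inj_on (corner k) {..<k}"
  using bij_betw_imp_inj_on[OF Complex.bij_betw_roots_unity] unfolding corner_def by blast

lemma corner_in_side: "corner k j \<in> side k j" "corner k (Suc j) \<in> side k j"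
  unfolding corner_def side_def by (auto intro!: imageI divide_right_mono)

lemma sphere_eq_sides:
  assumes "k > 0"
  shows "sphere 0 1 = (\<Union>j<k. side k j)"
proof
  show "(\<Union>j<k. side k j) \<subseteq> sphere 0 1" unfolding side_def by auto
  show "sphere 0 1 \<subseteq> (\<Union>j<k. side k j)"
  proof
    fix z :: complex assume "z \<in> sphere 0 1"
    then have "norm z = 1" by simp
    then obtain \<theta> where \<theta>: "0 \<le> \<theta>" "\<theta> < 2 * pi" "z = cis \<theta>"
      by (metis complex_unimodular_polar cis.ctr complex.exhaust_sel)
    let ?x = "\<theta> * real k / (2 * pi)"
    define j where "j = nat \<lfloor>?x\<rfloor>"
    have x: "0 \<le> ?x" "?x < real k" using \<theta> assms by (auto simp: field_simps)
    then have j: "real j \<le> ?x" "?x < real j + 1" unfolding j_def by linarith+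
    then have "j < k" using x by linarith
    moreover have "\<theta> \<in> {2 * pi * real j / real k .. 2 * pi * real (Suc j) / real k}"
      using j assms by (auto simp: field_simps)
    ultimately show "z \<in> (\<Union>j<k. side k j)" using \<theta>(3) unfolding side_def by blast
  qed
qed

lemma edge_arcE:
  assumes "edge_arc X V e"
  obtains c where "homeomorphic_map (top_of_set {0..1::real}) (subtopology X e) c"
    "c ` {0..1} = e" "inj_on c {0..1}" "continuous_map (top_of_set {0..1}) X c" "e \<inter> V =
        {c 0, c 1}"
    "c 0 \<noteq> c 1"
proof -
  obtain c where c: "homeomorphic_map (top_of_set {0..1::real}) (subtopology X e) c"
    "e \<subseteq> topspace X" "e \<inter> V = {c 0, c 1}"
    using assms unfolding edge_arc_def by blast
  have "c ` {0..1} = e" using homeomorphic_imp_surjective_map[OF c(1)] c(2) by auto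
  moreover have inj: "inj_on c {0..1}" using homeomorphic_imp_injective_map[OF c(1)] by simp
  moreover have "continuous_map (top_of_set {0..1}) X c"
    using homeomorphic_imp_continuous_map[OF c(1)] by (simp add: continuous_map_in_subtopology)
  moreover have "c 0 \<noteq> c 1" using inj_onD[OF inj, of 0 1] by auto
  ultimately show thesis using that c by blast
qed

text \<open>An open set isolating \<open>p\<close> on the arc would pull back to a clopen singleton
  of the connected interval. This supplies the limit points for
  \<open>no_pinch_point\<close>.\<close>

lemma edge_derived:
  assumes "edge_arc X V e" "p \<in> e"
  shows "p \<in> X derived_set_of e"
  unfolding in_derived_set_of
proof (intro conjI allI impI)
  show "p \<in> topspace X" using assms unfolding edge_arc_def by blast
  fix T assume T: "p \<in> T \<and> openin X T"
  obtain c where c: "c ` {0..1::real} = e" "inj_on c {0..1}"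
      "continuous_map (top_of_set {0..1}) X c"
    using assms(1) by (rule edge_arcE)
  obtain s where s: "s \<in> {0..1}" "p = c s" using c(1) assms(2) by blast
  show "\<exists>y. y \<noteq> p \<and> y \<in> e \<and> y \<in> T"
  proof (rule ccontr)
    assume neg: "\<not> ?thesis"
    have "openin (top_of_set {0..1}) {x \<in> {0..1}. c x \<in> T}"
      using openin_continuous_map_preimage[OF c(3), of T] T by simp
    moreover have "{x \<in> {0..1}. c x \<in> T} = {s}"
    proof -
      have "x = s" if "x \<in> {0..1}" "c x \<in> T" for x
        using neg that c(1) s inj_onD[OF c(2), of x s] by blast
      then show ?thesis using s T by blast
    qed
    ultimately have "openin (top_of_set {0..1}) {s}" by simp
    moreover have "closedin (top_of_set {0..1}) {s}" using s(1) by (simp add: closed_subset)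
    ultimately have "{s} = {0..1::real}"
      using connected_Icc[of 0 "1::real"] unfolding connected_clopen by blast
    then have "0 = s" "1 = s" by (metis atLeastAtMost_iff order_refl singletonD zero_le_one)+
    then show False by simp
  qed
qed

section \<open>Cells of a subdivided closed surface\<close>

locale charted_subdivision =
  fixes X :: "'a topology" and V :: "'a set" and E F :: "'a set set"
    and k :: "'a set \<Rightarrow> nat" and d :: "'a set \<Rightarrow> complex \<Rightarrow> 'a"
  assumes surface: "closed_surface X"
    and subdivision: "polygonal_subdivision X V E F"
    and chart: "\<And>t. t \<in> F \<Longrightarrow> 2 \<le> k t \<and>
        polygon_chart X V E (k t) t (d t)"
begin

text \<open>The index is any natural number, read modulo the number of sides, so the successor of
  the last corner is no special case.\<close>

definition vtx :: "'a set \<Rightarrow> nat \<Rightarrow> 'a" where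
  "vtx t j = d t (corner (k t) j)"

definition dart :: "'a set \<Rightarrow> nat \<Rightarrow> 'a \<times> 'a" where
  "dart t j = (vtx t j, vtx t (Suc j))"

definition boundary_word :: "'a set \<Rightarrow> ('a \<times> 'a) list" where
  "boundary_word t = map (dart t) [0..<k t]"

definition darts :: "('a \<times> 'a) set" where
  "darts = {(p, q). p \<noteq> q \<and> (\<exists>e\<in>E. e \<inter> V = {p, q})}"

lemma finite_V: "finite V" and finite_E: "finite E" and finite_F: "finite F"
  and V_subset: "V \<subseteq> topspace X"
  and edge: "e \<in> E \<Longrightarrow> edge_arc X V e"
  and topspace_eq: "topspace X = V \<union> \<Union>E \<union> \<Union>F"
  and edges_meet: "\<lbrakk>e \<in> E; e' \<in> E; e \<noteq> e'\<rbrakk> \<Longrightarrow>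
      e \<inter> e' \<subseteq> V"
  and tiles_meet: "\<lbrakk>t \<in> F; t' \<in> F; t \<noteq> t'\<rbrakk> \<Longrightarrow>
      t \<inter> t' \<subseteq> \<Union>E"
  using subdivision unfolding polygonal_subdivision_def by (simp_all add: Un_assoc)

lemma Hausdorff: "Hausdorff_space X"
  using surface unfolding closed_surface_def by blast

lemma
  assumes "t \<in> F"
  shows two_le_k: "2 \<le> k t" and k_pos: "0 < k t"
    and tile_subset: "t \<subseteq> topspace X"
    and tile_homeo: "homeomorphic_map (top_of_set (cball 0 1)) (subtopology X t) (d t)"
    and vtx_in_V': "j < k t \<Longrightarrow> vtx t j \<in> V"
    and side_in_E: "j < k t \<Longrightarrow> d t ` side (k t) j \<in> E"
    and interior_disjoint: "d t ` ball 0 1 \<inter> (V \<union> \<Union>E) = {}"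
  using chart[OF assms] unfolding polygon_chart_def vtx_def by auto

lemma
  assumes "t \<in> F"
  shows tile_image: "d t ` cball 0 1 = t"
    and tile_inj: "inj_on (d t) (cball 0 1)"
    and tile_continuous: "continuous_map (top_of_set (cball 0 1)) X (d t)"
  using homeomorphic_imp_surjective_map[OF tile_homeo[OF assms]]
    homeomorphic_imp_injective_map[OF tile_homeo[OF assms]] tile_subset[OF assms]
    homeomorphic_imp_continuous_map[OF tile_homeo[OF assms]]
  by (auto simp: continuous_map_in_subtopology Int_absorb1)

lemma closedin_tile:
  assumes "t \<in> F"
  shows "closedin X t"
proof -
  have "compactin (top_of_set (cball (0::complex) 1)) (cball 0 1)"
    by (simp add: compactin_subtopology)
  from image_compactin[OF this tile_continuous[OF assms]]
  show ?thesis using compactin_imp_closedin[OF Hausdorff] by (simp add: tile_image[OF assms])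
qed

lemma closedin_edge:
  assumes "e \<in> E"
  shows "closedin X e"
proof -
  obtain c where c: "c ` {0..1::real} = e" "continuous_map (top_of_set {0..1}) X c"
    using edge[OF assms] by (rule edge_arcE)
  have "compactin (top_of_set {0..1::real}) {0..1}"
    by (simp add: compactin_subtopology)
  from image_compactin[OF this c(2)]
  show ?thesis using compactin_imp_closedin[OF Hausdorff] by (simp add: c(1))
qed

lemma closedin_Union_tiles: "K \<subseteq> F \<Longrightarrow> closedin X (\<Union>K)"
  by (rule closedin_Union) (use finite_F finite_subset closedin_tile in blast)+

lemma closedin_Union_edges: "K \<subseteq> E \<Longrightarrow> closedin X (\<Union>K)"
  by (rule closedin_Union) (use finite_E finite_subset closedin_edge in blast)+

lemma closedin_vertices: "A \<subseteq> V \<Longrightarrow> closedin X A"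
  using closedin_Hausdorff_finite[OF Hausdorff, of A] finite_V V_subset finite_subset by blast

lemma vtx_mod:
  assumes "t \<in> F"
  shows "vtx t (j mod k t) = vtx t j"
  unfolding vtx_def corner_mod[OF k_pos[OF assms]] ..

lemma vtx_in_V: "t \<in> F \<Longrightarrow> vtx t j \<in> V"
  using vtx_mod[of t j] vtx_in_V'[of t "j mod k t"] k_pos[of t] by simp

lemma inj_on_vtx:
  assumes "t \<in> F"
  shows "inj_on (vtx t) {..<k t}"
proof -
  have "corner (k t) ` {..<k t} \<subseteq> cball 0 1" unfolding corner_def by auto
  then have "inj_on (d t \<circ> corner (k t)) {..<k t}"
    using inj_on_corner[OF k_pos[OF assms]] inj_on_subset[OF tile_inj[OF assms]] comp_inj_on
        by blast
  then show ?thesis by (simp add: inj_on_def vtx_def)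
qed

lemma vtx_Suc_neq:
  assumes "t \<in> F"
  shows "vtx t (Suc j) \<noteq> vtx t j"
proof
  assume "vtx t (Suc j) = vtx t j"
  then have "vtx t (Suc j mod k t) = vtx t (j mod k t)" by (simp only: vtx_mod[OF assms])
  then have "Suc j mod k t = j mod k t"
    using inj_onD[OF inj_on_vtx[OF assms]] k_pos[OF assms] by simp
  then show False using two_le_k[OF assms] by (simp add: mod_Suc split: if_splits)
qed

text \<open>The two corners are distinct vertices on the edge, and an edge contains only two
  vertices.\<close>

lemma side_ends:
  assumes "t \<in> F" "j < k t"
  shows "d t ` side (k t) j \<inter> V = {vtx t j, vtx t (Suc j)}"
proof -
  obtain c :: "real \<Rightarrow> 'a" where c: "d t ` side (k t) j \<inter> V = {c 0, c 1}"
    using edge[OF side_in_E[OF assms]] by (rule edge_arcE)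
  have "vtx t j \<in> d t ` side (k t) j \<inter> V"
      "vtx t (Suc j) \<in> d t ` side (k t) j \<inter> V"
    using vtx_in_V[OF assms(1)] corner_in_side[of "k t" j] unfolding vtx_def by blast+
  with vtx_Suc_neq[OF assms(1), of j] show ?thesis unfolding c by auto
qed

lemma side_subset: "t \<in> F \<Longrightarrow> j < k t \<Longrightarrow>
    d t ` side (k t) j \<subseteq> t"
  using sphere_eq_sides[OF k_pos[of t]] tile_image[of t] sphere_cball[of 0 1] by blast

lemma tile_boundary:
  assumes "t \<in> F" "x \<in> t" "x \<in> V \<union> \<Union>E"
  obtains j where "j < k t" "x \<in> d t ` side (k t) j"
proof -
  obtain z where z: "z \<in> cball 0 1" "x = d t z" using assms tile_image by blast
  have "z \<notin> ball 0 1" using interior_disjoint[OF assms(1)] z assms(3) by blast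
  with z(1) have "z \<in> sphere 0 1" by simp
  then show thesis using that z(2) sphere_eq_sides[OF k_pos[OF assms(1)]] by blast
qed

lemma tile_edge:
  assumes "t \<in> F" "e \<in> E" "x \<in> e" "x \<in> t" "x \<notin> V"
  obtains j where "j < k t" "e = d t ` side (k t) j"
proof -
  obtain j where j: "j < k t" "x \<in> d t ` side (k t) j"
    by (rule tile_boundary[of t x]) (use assms in blast)+
  with side_in_E[OF assms(1) j(1)] edges_meet[of e] assms(2-5) have "e = d t ` side (k t) j"
    by blast
  with j that show thesis by blast
qed

lemma tile_vertex:
  assumes "t \<in> F" "x \<in> t" "x \<in> V"
  obtains j where "j < k t" "x = vtx t j"
proof -
  obtain j where j: "j < k t" "x \<in> d t ` side (k t) j"
    by (rule tile_boundary[of t x]) (use assms in blast)+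
  then have "x = vtx t j \<or> x = vtx t (Suc j)" using side_ends[OF assms(1) j(1)] assms(3)
      by blast
  then have "x = vtx t (j mod k t) \<or> x = vtx t (Suc j mod k t)"
      by (simp only: vtx_mod[OF assms(1)])
  then show thesis using that[of "j mod k t"] that[of "Suc j mod k t"] k_pos[OF assms(1)] by auto
qed

lemma edge_interior_point:
  assumes "e \<in> E"
  obtains x where "x \<in> e" "x \<notin> V"
proof -
  obtain c where c: "c ` {0..1::real} = e" "inj_on c {0..1}" "e \<inter> V = {c 0, c 1}"
    using edge[OF assms] by (rule edge_arcE)
  have "c (1/2) \<noteq> c 0" "c (1/2) \<noteq> c 1"
    using inj_onD[OF c(2), of "1/2" 0] inj_onD[OF c(2), of "1/2" 1] by auto
  moreover have "c (1/2) \<in> c ` {0..1}" by (intro imageI) simp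
  then have "c (1/2) \<in> e" by (simp only: c(1))
  ultimately show thesis using that c(3) by blast
qed

lemma edge_subset_tile:
  assumes "t \<in> F" "e \<in> E" "x \<in> e" "x \<in> t" "x \<notin> V"
  shows "e \<subseteq> t"
  by (rule tile_edge[OF assms]) (use side_subset[OF assms(1)] in blast)

lemma edge_side_of_tile:
  assumes "t \<in> F" "e \<in> E" "e \<subseteq> t"
  obtains j where "j < k t" "e = d t ` side (k t) j"
proof -
  obtain x where x: "x \<in> e" "x \<notin> V" by (rule edge_interior_point[OF assms(2)])
  have "x \<in> t" using x(1) assms(3) by blast
  from assms(1,2) x(1) this x(2) show thesis by (rule tile_edge) (rule that)
qed

text \<open>An edge on at most one tile would make the surface locally a half-disc or an arc there,
  against invariance of domain.\<close>

lemma edge_in_two_tiles: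
  assumes e: "e \<in> E"
  obtains t t' where "t \<in> F" "t' \<in> F" "t \<noteq> t'" "e \<subseteq> t" "e \<subseteq> t'"
proof (rule ccontr)
  note those = that
  assume neg: "\<not> thesis"
  obtain p where p: "p \<in> e" "p \<notin> V" using edge_interior_point[OF e] by blast
  \<comment> \<open>Removing all other cells leaves a neighbourhood of \<open>p\<close> made of the
    open edge \<open>e\<close> and the open tiles that have \<open>e\<close> as a side.\<close>
  define N where "N = topspace X - (V \<union> \<Union>(E - {e}) \<union> \<Union>{t\<in>F. \<not> e \<subseteq> t})"
  have "closedin X (V \<union> \<Union>(E - {e}) \<union> \<Union>{t\<in>F. \<not> e \<subseteq> t})"
    by (intro closedin_Un closedin_vertices closedin_Union_edges closedin_Union_tiles) auto
  then have N: "openin X N" unfolding N_def by blast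
  have "p \<in> N"
    unfolding N_def using p e edges_meet[OF e] edge_subset_tile[OF _ e p(1) _ p(2)] topspace_eq
        by blast
  show False
  proof (cases "\<exists>t\<in>F. e \<subseteq> t")
    case True
    then obtain t where t: "t \<in> F" "e \<subseteq> t" by blast
    have "t' = t" if "t' \<in> F" "e \<subseteq> t'" for t' 
    proof (rule ccontr)
      assume "t' \<noteq> t"
      from those[OF that(1) t(1) this that(2) t(2)] neg show False by blast
    qed
    then have "\<Union>F \<subseteq> t \<union> \<Union>{t\<in>F. \<not> e \<subseteq> t}"
        "\<Union>E \<subseteq> t \<union> \<Union>(E - {e})" using t by blast+
    then have "N \<subseteq> t" unfolding N_def topspace_eq by blast
    \<comment> \<open>With a single tile at \<open>e\<close>, its inverse chart maps
      \<open>N\<close> onto an open set inside the closed disc, hence inside the open disc, although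
      \<open>p\<close> lies on the boundary.\<close>
    obtain g where g: "homeomorphic_maps (top_of_set (cball 0 1)) (subtopology X t) (d t) g"
      using tile_homeo[OF t(1)] unfolding homeomorphic_map_maps by blast
    have dg: "d t (g x) = x" "g x \<in> cball 0 1" if "x \<in> t" for x
      using g that tile_subset[OF t(1)]
          by (auto simp: homeomorphic_maps_def continuous_map_def Pi_iff)
    have "continuous_map (subtopology X t) euclidean g"
      using g by (simp add: homeomorphic_maps_def continuous_map_in_subtopology)
    then have "continuous_map (subtopology X N) euclidean g"
      using continuous_map_from_subtopology_mono \<open>N \<subseteq> t\<close> by blast
    moreover have "inj_on g N" using dg(1) \<open>N \<subseteq> t\<close> by (metis inj_onI subsetD)
    ultimately have "open (g ` N)" using open_image_surface[OF surface N] by blast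
    moreover have "g ` N \<subseteq> cball 0 1" using dg(2) \<open>N \<subseteq> t\<close> by blast
    ultimately have "g ` N \<subseteq> ball 0 1" by (metis interior_cball interior_maximal)
    then have "d t (g p) \<in> d t ` ball 0 1" using \<open>p \<in> N\<close> by blast
    then have "p \<in> d t ` ball 0 1" using dg(1) p(1) t(2) by (metis subsetD)
    then show False using interior_disjoint[OF t(1)] p(1) e by blast
  next
    case False
    then have "\<Union>F \<subseteq> \<Union>{t\<in>F. \<not> e \<subseteq> t}"
        "\<Union>E \<subseteq> e \<union> \<Union>(E - {e})" by blast+
    then have "N \<subseteq> e" unfolding N_def topspace_eq by blast
    obtain c where c: "homeomorphic_map (top_of_set {0..1::real}) (subtopology X e) c"
      using edge[OF e] by (rule edge_arcE)
    then obtain g where g: "homeomorphic_maps (top_of_set {0..1::real}) (subtopology X e) c g"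
      unfolding homeomorphic_map_maps by blast
    have cg: "c (g x) = x" if "x \<in> e" for x
      using g that closedin_subset[OF closedin_edge[OF e]] by (auto simp: homeomorphic_maps_def)
    have "continuous_map (subtopology X e) euclidean g"
      using g by (simp add: homeomorphic_maps_def continuous_map_in_subtopology)
    then have "continuous_map (subtopology X N) euclidean g"
      using continuous_map_from_subtopology_mono \<open>N \<subseteq> e\<close> by blast
    moreover have "continuous_map euclidean euclidean complex_of_real"
      by (simp add: continuous_on_of_real_id)
    ultimately have "continuous_map (subtopology X N) euclidean (complex_of_real \<circ> g)"
      by (rule continuous_map_compose)
    moreover have "inj_on (complex_of_real \<circ> g) N"
      using cg \<open>N \<subseteq> e\<close>
          by (intro inj_onI) (metis comp_apply of_real_eq_iff subsetD)
    ultimately have "open ((complex_of_real \<circ> g) ` N)" using open_image_surface[OF surface N]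
        by blast
    then obtain r where r: "r > 0"
        "ball (complex_of_real (g p)) r \<subseteq> (complex_of_real \<circ> g) ` N"
      using \<open>p \<in> N\<close> unfolding open_contains_ball by force
    \<comment> \<open>With no tile at \<open>e\<close>, the open image would lie on the real axis;
      this point of the ball has imaginary part \<open>r / 2\<close>.\<close>
    have "complex_of_real (g p) + \<i> * complex_of_real (r / 2) \<in> ball (complex_of_real (g p)) r"
      using r(1) by (simp add: dist_norm norm_mult)
    then obtain s where "complex_of_real (g p) + \<i> * complex_of_real (r / 2) = complex_of_real s"
      using r(2) by auto
    then have "Im (complex_of_real (g p) + \<i> * complex_of_real (r / 2)) = 0" by simp
    then show False using r(1) by simp
  qed
qed

text \<open>A vertex on no edge would be on no tile either, hence isolated; a map of this single
  point to the plane would have an open image.\<close>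

lemma vertex_on_edge:
  assumes p: "p \<in> V"
  obtains e where "e \<in> E" "p \<in> e"
proof (rule ccontr)
  assume "\<not> thesis"
  then have ne: "p \<notin> \<Union>E" using that by blast
  have "p \<notin> \<Union>F"
  proof
    assume "p \<in> \<Union>F"
    then obtain t where t: "t \<in> F" "p \<in> t" by blast
    obtain j where "j < k t" "p \<in> d t ` side (k t) j"
      by (rule tile_boundary[OF t]) (use p in blast)
    then show False using ne side_in_E[OF t(1)] by blast
  qed
  define N where "N = topspace X - ((V - {p}) \<union> \<Union>E \<union> \<Union>F)"
  have "closedin X ((V - {p}) \<union> \<Union>E \<union> \<Union>F)"
    by (intro closedin_Un closedin_vertices closedin_Union_edges closedin_Union_tiles) auto
  then have N: "openin X N" unfolding N_def by blast
  have "N = {p}" unfolding N_def topspace_eq using p ne \<open>p \<notin> \<Union>F\<close> by blast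
  have "open ((\<lambda>_. 0::complex) ` N)"
    by (rule open_image_surface[OF surface N]) (auto simp: \<open>N = {p}\<close>)
  then show False using not_open_singleton[of "0::complex"] by (simp add: \<open>N = {p}\<close>)
qed

lemma tiles_cover: "topspace X = \<Union>F"
proof
  show "\<Union>F \<subseteq> topspace X" unfolding topspace_eq by blast
  have "e \<subseteq> \<Union>F" if "e \<in> E" for e by (rule edge_in_two_tiles[OF that]) blast
  then have "\<Union>E \<subseteq> \<Union>F" by blast
  moreover have "p \<in> \<Union>E" if "p \<in> V" for p by (rule vertex_on_edge[OF that]) blast
  then have "V \<subseteq> \<Union>E" by blast
  ultimately show "topspace X \<subseteq> \<Union>F" unfolding topspace_eq by blast
qed

text \<open>Counting vertices shows that the number of sides depends on the tile and not on the
  chart.\<close>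

lemma card_tile_vertices:
  assumes "t \<in> F"
  shows "t \<inter> V = vtx t ` {..<k t}" "card (t \<inter> V) = k t"
proof -
  have "vtx t j \<in> t" if "j < k t" for j
    using side_subset[OF assms that] side_ends[OF assms that] by blast
  then have "vtx t ` {..<k t} \<subseteq> t \<inter> V" using vtx_in_V[OF assms] by blast
  moreover have "t \<inter> V \<subseteq> vtx t ` {..<k t}"
  proof
    fix x assume "x \<in> t \<inter> V"
    then obtain j where "j < k t" "x = vtx t j" using tile_vertex[OF assms] by blast
    then show "x \<in> vtx t ` {..<k t}" by blast
  qed
  ultimately show "t \<inter> V = vtx t ` {..<k t}" by blast
  then show "card (t \<inter> V) = k t" using card_image[OF inj_on_vtx[OF assms]] by simp
qed

end

section \<open>Directed edges of an oriented simple subdivision\<close>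

locale oriented_subdivision = charted_subdivision +
  assumes oriented: "\<And>t t' i j. \<lbrakk>t \<in> F; t' \<in> F; t \<noteq> t'; i < k t; j < k t';
        d t ` side (k t) i = d t' ` side (k t') j\<rbrakk> \<Longrightarrow> d t (corner (k t) i) \<noteq> d t' (corner (k t') j)"
    and simple: "simple_subdivision V E"

context oriented_subdivision
begin

lemma dart_mod:
  assumes "t \<in> F"
  shows "dart t (j mod k t) = dart t j"
proof -
  have "vtx t (Suc (j mod k t)) = vtx t (Suc (j mod k t) mod k t)" by (simp only: vtx_mod[OF assms])
  also have "\<dots> = vtx t (Suc j)" by (simp only: mod_Suc_eq vtx_mod[OF assms])
  finally show ?thesis unfolding dart_def by (simp only: vtx_mod[OF assms])
qed

lemma length_boundary_word [simp]: "length (boundary_word t) = k t"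
  by (simp add: boundary_word_def)

lemma set_boundary_word: "set (boundary_word t) = dart t ` {..<k t}"
  by (auto simp: boundary_word_def)

lemma dart_in_boundary_word: "t \<in> F \<Longrightarrow> dart t j \<in> set (boundary_word t)"
  using dart_mod[of t j] k_pos[of t] unfolding set_boundary_word
      by (metis image_eqI lessThan_iff mod_less_divisor)

lemma cyc_invariant_boundary_word:
  assumes "t \<in> F" "cyc_invariant S (boundary_word t)"
  shows "(vtx t (Suc j), vtx t j) \<in> S \<longleftrightarrow>
      (vtx t (Suc j), vtx t (Suc (Suc j))) \<in> S"
proof -
  have j: "j mod k t < k t" using k_pos[OF assms(1)] by simp
  have nth: "boundary_word t ! (i mod k t) = dart t i" for i
    using dart_mod[OF assms(1), of i] k_pos[OF assms(1)] by (simp add: boundary_word_def)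
  have "prod.swap (boundary_word t ! (j mod k t)) \<in> S \<longleftrightarrow>
      boundary_word t ! (Suc (j mod k t) mod k t) \<in> S"
    using assms(2) j unfolding cyc_invariant_nth length_boundary_word by blast
  then show ?thesis unfolding mod_Suc_eq nth unfolding dart_def by simp
qed

lemma edges_eqI: "\<lbrakk>e \<in> E; e' \<in> E; e \<inter> V =
    e' \<inter> V\<rbrakk> \<Longrightarrow> e = e'"
  using simple unfolding simple_subdivision_def by blast

lemma inj_on_dart: "t \<in> F \<Longrightarrow> inj_on (dart t) {..<k t}"
  using inj_on_vtx[of t] by (auto simp: inj_on_def dart_def)

text \<open>As edges are determined by their ends, a common directed edge is a common side with the
  same starting point, which the orientation forbids for two different tiles.\<close>

lemma boundary_words_disjoint:
  assumes "t \<in> F" "t' \<in> F" "x \<in> set (boundary_word t)" "x \<in> set (boundary_word t')"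
  shows "t = t'"
proof (rule ccontr)
  assume "t \<noteq> t'"
  obtain i j where ij: "i < k t" "j < k t'" "dart t i = dart t' j"
    using assms(3,4) unfolding set_boundary_word by auto
  then have v: "vtx t i = vtx t' j" "vtx t (Suc i) = vtx t' (Suc j)" unfolding dart_def by auto
  have "d t ` side (k t) i = d t' ` side (k t') j"
    by (rule edges_eqI) (use assms ij v in \<open>simp_all add: side_in_E side_ends\<close>)
  from oriented[OF assms(1,2) \<open>t \<noteq> t'\<close> ij(1,2) this] v show False
      unfolding vtx_def by simp
qed

lemma dart_in_darts:
  assumes "t \<in> F"
  shows "dart t j \<in> darts"
proof -
  have j: "j mod k t < k t" using k_pos[OF assms] by simp
  have "dart t (j mod k t) \<in> darts"
    using side_in_E[OF assms j] side_ends[OF assms j] vtx_Suc_neq[OF assms]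
    unfolding darts_def dart_def by (auto simp: eq_commute)
  then show ?thesis by (simp only: dart_mod[OF assms])
qed

text \<open>Two tiles at an edge induce opposite directions on it, so together they traverse it both
  ways.\<close>

lemma dartE:
  assumes "x \<in> darts"
  obtains t where "t \<in> F" "x \<in> set (boundary_word t)"
proof -
  obtain p q e where x: "x = (p, q)" "p \<noteq> q" "e \<in> E" "e \<inter> V = {p, q}"
    using assms unfolding darts_def by auto
  obtain t t' where t: "t \<in> F" "t' \<in> F" "t \<noteq> t'" "e \<subseteq> t" "e \<subseteq> t'"
    by (rule edge_in_two_tiles[OF x(3)])
  obtain i where i: "i < k t" "e = d t ` side (k t) i"
    by (rule edge_side_of_tile[OF t(1) x(3) t(4)])
  obtain j where j: "j < k t'" "e = d t' ` side (k t') j"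
    by (rule edge_side_of_tile[OF t(2) x(3) t(5)])
  have "vtx t i \<noteq> vtx t' j"
    using oriented[OF t(1-3) i(1) j(1)] i(2) j(2) unfolding vtx_def by simp
  moreover have "{vtx t i, vtx t (Suc i)} = {p, q}" "{vtx t' j, vtx t' (Suc j)} = {p, q}"
    using side_ends[OF t(1) i(1)] side_ends[OF t(2) j(1)] i(2) j(2) x(4) by simp_all
  ultimately have "x = dart t i \<or> x = dart t' j"
    unfolding x(1) dart_def by (auto simp: doubleton_eq_iff)
  then show thesis using that t(1,2) dart_in_boundary_word by blast
qed

lemma darts_eq: "(\<Union>t\<in>F. set (boundary_word t)) = darts"
proof
  show "(\<Union>t\<in>F. set (boundary_word t)) \<subseteq> darts" using dart_in_darts
      by (auto simp: set_boundary_word)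
  show "darts \<subseteq> (\<Union>t\<in>F. set (boundary_word t))"
      by (rule subsetI, erule dartE) blast
qed

lemma swap_darts: "x \<in> darts \<Longrightarrow> prod.swap x \<in> darts"
  unfolding darts_def by (auto simp: insert_commute)

lemma edge_ends:
  assumes "e \<in> E"
  obtains p q where "p \<noteq> q" "e \<inter> V = {p, q}"
  using edge[OF assms] by (rule edge_arcE) blast

lemma fst_darts: "fst ` darts = V"
proof
  show "fst ` darts \<subseteq> V"
  proof
    fix p assume "p \<in> fst ` darts"
    then obtain q where "(p, q) \<in> darts" by force
    then obtain e where "e \<inter> V = {p, q}" unfolding darts_def by blast
    then show "p \<in> V" by blast
  qed
  show "V \<subseteq> fst ` darts"
  proof
    fix p assume p: "p \<in> V"
    obtain e where e: "e \<in> E" "p \<in> e" by (rule vertex_on_edge[OF p])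
    obtain q r where qr: "q \<noteq> r" "e \<inter> V = {q, r}" by (rule edge_ends[OF e(1)])
    have "(q, r) \<in> darts" unfolding darts_def using e(1) qr by blast
    with swap_darts[OF this] have "q \<in> fst ` darts" "r \<in> fst ` darts" by force+
    moreover have "p = q \<or> p = r" using qr e(2) p by blast
    ultimately show "p \<in> fst ` darts" by blast
  qed
qed

lemma card_darts: "card darts = 2 * card E"
proof -
  let ?D = "\<lambda>e. {(p, q). p \<noteq> q \<and> e \<inter> V = {p, q}}"
  have D: "finite (?D e) \<and> card (?D e) = 2" if e: "e \<in> E" for e
  proof -
    obtain q r where qr: "q \<noteq> r" "e \<inter> V = {q, r}" by (rule edge_ends[OF e])
    then have "?D e = {(q, r), (r, q)}" by (auto simp: doubleton_eq_iff)
    then show ?thesis using qr(1) by simp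
  qed
  have "darts = (\<Union>e\<in>E. ?D e)" unfolding darts_def by auto
  also have "card \<dots> = (\<Sum>e\<in>E. card (?D e))"
  proof (rule card_UN_disjoint)
    show "\<forall>i\<in>E. \<forall>j\<in>E. i \<noteq> j \<longrightarrow> ?D i \<inter> ?D j =
        {}"
    proof (intro ballI impI)
      fix i j assume ij: "i \<in> E" "j \<in> E" "i \<noteq> j"
      then have "i \<inter> V \<noteq> j \<inter> V" using edges_eqI by blast
      then show "?D i \<inter> ?D j = {}" by fastforce
    qed
  qed (use finite_E D in blast)+
  finally show ?thesis using D by simp
qed

text \<open>The corner is indexed by a successor so that both of its neighbours in the tile can be
  named.\<close>

lemma vertex_darts:
  assumes "t \<in> F" "e \<in> E" "e \<subseteq> t" "p \<in> V" "e \<inter> V = {p, q}"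
      "p \<noteq> q"
  obtains j where "p = vtx t (Suc j)" "q = vtx t j \<or> q = vtx t (Suc (Suc j))"
proof -
  obtain i where i: "i < k t" "e = d t ` side (k t) i"
    by (rule edge_side_of_tile[OF assms(1-3)])
  have "{vtx t i, vtx t (Suc i)} = {p, q}" using side_ends[OF assms(1) i(1)] i(2) assms(5) by simp
  then consider "p = vtx t (Suc i)" "q = vtx t i" | "p = vtx t i" "q = vtx t (Suc i)"
    by (auto simp: doubleton_eq_iff)
  then show thesis
  proof cases
    case 1
    then show thesis using that by blast
  next
    case 2
    \<comment> \<open>Shifting the index by a full turn makes it positive, hence a
      successor.\<close>
    have "vtx t (m + k t) = vtx t m" for m
      using vtx_mod[OF assms(1), of "m + k t"] vtx_mod[OF assms(1), of m]
          by (simp only: mod_add_self2)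
    from this[of i] this[of "Suc i"] have "vtx t (i + k t) = vtx t i" "vtx t (Suc (i + k t)) =
        vtx t (Suc i)"
      by (simp_all only: add_Suc)
    moreover have "i + k t = Suc (i + k t - 1)" using k_pos[OF assms(1)] by simp
    ultimately have "p = vtx t (Suc (i + k t - 1))" "q = vtx t (Suc (Suc (i + k t - 1)))"
      using 2 by simp_all
    then show thesis using that by blast
  qed
qed

lemma vtx_eqD:
  assumes "t \<in> F" "vtx t (Suc i) = vtx t (Suc j)"
  shows "vtx t i = vtx t j" "vtx t (Suc (Suc i)) = vtx t (Suc (Suc j))"
proof -
  have "vtx t (Suc i mod k t) = vtx t (Suc j mod k t)" by (simp only: vtx_mod[OF assms(1)] assms(2))
  then have S: "Suc i mod k t = Suc j mod k t"
    using inj_onD[OF inj_on_vtx[OF assms(1)]] k_pos[OF assms(1)] by simp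
  then have "(Suc i + (k t - 1)) mod k t = (Suc j + (k t - 1)) mod k t" by (metis mod_add_left_eq)
  then have "i mod k t = j mod k t" using k_pos[OF assms(1)] by simp
  then show "vtx t i = vtx t j" by (metis vtx_mod[OF assms(1)])
  have "Suc (Suc i) mod k t = Suc (Suc j) mod k t" using S by (metis mod_Suc_eq)
  then show "vtx t (Suc (Suc i)) = vtx t (Suc (Suc j))" by (metis vtx_mod[OF assms(1)])
qed

text \<open>By invariance, whether the edges leaving \<open>p\<close> belong to \<open>S\<close> is
  a property of each tile at \<open>p\<close>, and tiles sharing an edge at \<open>p\<close> agree.
  If both answers occurred, the tiles of the two kinds would meet near \<open>p\<close> in
  \<open>p\<close> only: a pinch point.\<close>

lemma one_orbit:
  assumes inv: "\<And>t. t \<in> F \<Longrightarrow> cyc_invariant S (boundary_word t)"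
    and pq: "(p, q) \<in> darts" "(p, q') \<in> darts" and "(p, q) \<in> S"
  shows "(p, q') \<in> S"
proof (rule ccontr)
  assume notin: "(p, q') \<notin> S"
  let ?in = "\<lambda>t. \<exists>j. vtx t (Suc j) = p \<and> (vtx t (Suc j), vtx t j) \<in> S"
  have p: "p \<in> V" using pq(1) fst_darts by force
  have in_iff: "(p, r) \<in> S \<longleftrightarrow> ?in t"
    if te: "t \<in> F" "e \<in> E" "e \<subseteq> t" "e \<inter> V = {p, r}" "p \<noteq> r"
        for t e r
  proof -
    obtain j where j: "p = vtx t (Suc j)" "r = vtx t j \<or> r = vtx t (Suc (Suc j))"
      by (rule vertex_darts[OF te(1-3) p te(4,5)])
    have pr: "(p, r) \<in> S \<longleftrightarrow> (vtx t (Suc j), vtx t j) \<in> S"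
      using cyc_invariant_boundary_word[OF te(1) inv[OF te(1)], of j] j by auto
    show ?thesis
    proof
      assume "?in t"
      then obtain i where i: "vtx t (Suc i) = p" "(vtx t (Suc i), vtx t i) \<in> S" by blast
      have ij: "vtx t (Suc i) = vtx t (Suc j)" using i(1) j(1) by simp
      from i(2) show "(p, r) \<in> S"
        unfolding pr vtx_eqD(1)[OF te(1) ij] ij .
    qed (use pr j(1) in blast)
  qed
  let ?A = "\<Union>{t\<in>F. p \<in> t \<and> ?in t}" and ?C = "\<Union>{t\<in>F. p \<in> t \<and>
      \<not> ?in t}"
  \<comment> \<open>The open star of \<open>p\<close>: all cells whose closure avoids
    \<open>p\<close> are removed.\<close>
  define N where "N = topspace X - ((V - {p}) \<union> \<Union>{e\<in>E. p \<notin> e} \<union> \<Union>{t\<in>F. p \<notin> t})"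
  have "closedin X ((V - {p}) \<union> \<Union>{e\<in>E. p \<notin> e} \<union> \<Union>{t\<in>F. p \<notin> t})"
    by (intro closedin_Un closedin_vertices closedin_Union_edges closedin_Union_tiles) auto
  then have N: "openin X N" unfolding N_def by blast
  have "p \<in> N" unfolding N_def using p V_subset by blast
  have lim: "\<exists>t\<in>F. p \<in> t \<and> (?in t \<longleftrightarrow> (p, r) \<in> S) \<and>
      p \<in> X derived_set_of t" if r: "(p, r) \<in> darts" for r
  proof -
    obtain e where e: "p \<noteq> r" "e \<in> E" "e \<inter> V = {p, r}" using r unfolding darts_def
        by blast
    obtain t where t: "t \<in> F" "e \<subseteq> t" by (rule edge_in_two_tiles[OF e(2)])
    have "p \<in> e" using e(3) by blast
    have "p \<in> X derived_set_of t"
      using edge_derived[OF edge[OF e(2)] \<open>p \<in> e\<close>] derived_set_of_mono[OF t(2), of X] by blast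
    moreover have "p \<in> t" using \<open>p \<in> e\<close> t(2) by blast
    ultimately show ?thesis using t(1) in_iff[OF t(1) e(2) t(2) e(3,1)] by blast
  qed
  show False
  proof (rule no_pinch_point[OF surface N \<open>p \<in> N\<close>, of ?A ?C])
    show "closedin X ?A" "closedin X ?C" by (rule closedin_Union_tiles, blast)+
    have "\<Union>F \<subseteq> ?A \<union> ?C \<union> \<Union>{t\<in>F. p \<notin> t}" by blast
    then show "N \<subseteq> ?A \<union> ?C" unfolding N_def tiles_cover by blast
    show "N \<inter> ?A \<inter> ?C \<subseteq> {p}"
    proof
      fix x assume x: "x \<in> N \<inter> ?A \<inter> ?C"
      then obtain t t' where t: "t \<in> F" "t' \<in> F" "x \<in> t" "x \<in> t'" "?in t"
          "\<not> ?in t'" by blast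
      then have "t \<noteq> t'" by blast
      show "x \<in> {p}"
      proof (rule ccontr)
        assume "x \<notin> {p}"
        have xN: "x \<in> N" using x by blast
        then have xV: "x \<notin> V" using \<open>x \<notin> {p}\<close> unfolding N_def by blast
        \<comment> \<open>A point other than \<open>p\<close> shared by two tiles in the star is on
          an edge through \<open>p\<close>, and this edge settles the kind of both tiles.\<close>
        obtain e where e: "e \<in> E" "x \<in> e"
            using tiles_meet[OF t(1,2) \<open>t \<noteq> t'\<close>] t(3,4) by blast
        then have "p \<in> e" using xN unfolding N_def by blast
        obtain r where r: "e \<inter> V = {p, r}" "p \<noteq> r"
          using edge_ends[OF e(1)] \<open>p \<in> e\<close> p
              by (metis Int_iff doubleton_eq_iff insertE singletonD)
        have "e \<subseteq> t" "e \<subseteq> t'"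
          using edge_subset_tile[OF t(1) e(1,2) t(3) xV] edge_subset_tile[OF t(2) e(1,2) t(4) xV]
              by blast+
        then show False
          using in_iff[OF t(1) e(1) _ r] in_iff[OF t(2) e(1) _ r] t(5,6) by blast
      qed
    qed
    show "p \<in> X derived_set_of ?A"
    proof -
      obtain t where t: "t \<in> F" "p \<in> t" "?in t" "p \<in> X derived_set_of t"
        using lim[OF pq(1)] assms(4) by blast
      then have "t \<subseteq> ?A" by blast
      from derived_set_of_mono[OF this] t(4) show ?thesis by blast
    qed
    show "p \<in> X derived_set_of ?C"
    proof -
      obtain t where t: "t \<in> F" "p \<in> t" "\<not> ?in t" "p \<in> X derived_set_of t"
        using lim[OF pq(2)] notin by blast
      then have "t \<subseteq> ?C" by blast
      from derived_set_of_mono[OF this] t(4) show ?thesis by blast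
    qed
  qed
qed

text \<open>The directed edges of \<open>K\<close> form a union of orbits, so by
  \<open>one_orbit\<close> tiles with a common vertex are both in \<open>K\<close> or both outside;
  closure under reversal gives the same for a common edge. Thus \<open>K\<close> and
  \<open>F - K\<close> cover disjoint closed sets.\<close>

lemma tile_adjacency_connected:
  assumes conn: "connected_space X" and K: "K \<subseteq> F" "K \<noteq> {}"
    and closed: "prod.swap ` (\<Union>t\<in>K. set (boundary_word t)) \<subseteq> (\<Union>t\<in>K. set (boundary_word t))"
  shows "K = F"
proof (rule ccontr)
  assume "K \<noteq> F"
  let ?S = "\<Union>t\<in>K. set (boundary_word t)"
  have dart_S: "dart t j \<in> ?S \<longleftrightarrow> t \<in> K" if "t \<in> F" for t j
  proof
    assume "dart t j \<in> ?S"
    then obtain t' where t': "t' \<in> K" "dart t j \<in> set (boundary_word t')" by blast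
    have "t = t'"
      by (rule boundary_words_disjoint[OF that _ dart_in_boundary_word[OF that] t'(2)]) (use t'(1) K(1) in blast)
    then show "t \<in> K" using t'(1) by simp
  qed (use dart_in_boundary_word[OF that] in blast)
  have swap_S: "prod.swap x \<in> ?S \<longleftrightarrow> x \<in> ?S" for x
    using closed by (metis (no_types, lifting) image_subset_iff swap_swap)
  have "cyc_invariant ?S (boundary_word t)" if "t \<in> F" for t
  proof -
    have nth: "boundary_word t ! (i mod k t) = dart t i" for i
      using dart_mod[OF that, of i] k_pos[OF that] by (simp add: boundary_word_def)
    have "boundary_word t ! j \<in> ?S \<longleftrightarrow>
        boundary_word t ! (Suc j mod k t) \<in> ?S" if "j < k t" for j
      using nth[of j] nth[of
          "Suc j"] dart_S[OF \<open>t \<in> F\<close>, of j] dart_S[OF \<open>t \<in> F\<close>, of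
              "Suc j"] that
      by (simp only: mod_less)
    then show ?thesis unfolding cyc_invariant_nth length_boundary_word swap_S by blast
  qed
  note orbit = one_orbit[OF this]
  have "\<Union>K \<inter> \<Union>(F - K) = {}"
  proof (rule ccontr)
    assume "\<Union>K \<inter> \<Union>(F - K) \<noteq> {}"
    then obtain x t t' where t: "t \<in> K" "t' \<in> F" "t' \<notin> K" "x \<in> t" "x \<in> t'"
        by blast
    then have tF: "t \<in> F" using K(1) by blast
    show False
    proof (cases "x \<in> V")
      case True
      obtain i where i: "x = vtx t i" by (rule tile_vertex[OF tF t(4) True])
      obtain j where j: "x = vtx t' j" by (rule tile_vertex[OF t(2,5) True])
      have "(x, vtx t (Suc i)) \<in> darts" "(x, vtx t' (Suc j)) \<in> darts"
        using dart_in_darts[OF tF, of i] dart_in_darts[OF t(2), of j] i j unfolding dart_def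
            by simp_all
      moreover have "(x, vtx t (Suc i)) \<in> ?S" "(x, vtx t' (Suc j)) \<notin> ?S"
        using dart_S[OF tF, of i] dart_S[OF t(2), of j] t(1,3) i j unfolding dart_def by simp_all
      ultimately show False using orbit by blast
    next
      case False
      have "t \<noteq> t'" using t by blast
      then obtain e where e: "e \<in> E" "x \<in> e" using tiles_meet[OF tF t(2)] t(4,5) by blast
      obtain i where i: "i < k t" "e = d t ` side (k t) i" by (rule tile_edge[OF tF e t(4) False])
      obtain j where j: "j < k t'" "e = d t' ` side (k t') j"
          by (rule tile_edge[OF t(2) e t(5) False])
      have "vtx t i \<noteq> vtx t' j"
        using oriented[OF tF t(2) \<open>t \<noteq> t'\<close> i(1) j(1)] i(2) j(2)
            unfolding vtx_def by simp
      moreover have "{vtx t i, vtx t (Suc i)} = {vtx t' j, vtx t' (Suc j)}"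
        using side_ends[OF tF i(1)] side_ends[OF t(2) j(1)] i(2) j(2) by simp
      ultimately have "dart t' j = prod.swap (dart t i)"
        unfolding dart_def by (auto simp: doubleton_eq_iff)
      then show False using swap_S[of "dart t i"] dart_S[OF tF, of i] dart_S[OF t(2), of j] t(1,3)
          by simp
    qed
  qed
  moreover have "\<Union>K \<union> \<Union>(F - K) = topspace X" unfolding tiles_cover using K(1)
      by blast
  moreover have ne: "t \<noteq> {}" if "t \<in> F" for t using tile_image[OF that] by auto
  have "\<Union>K \<noteq> {}"
  proof -
    obtain t where "t \<in> K" using K(2) by blast
    then show ?thesis using ne[of t] K(1) by blast
  qed
  moreover have "\<Union>(F - K) \<noteq> {}"
  proof -
    obtain t where "t \<in> F - K" using K(1) \<open>K \<noteq> F\<close> by blast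
    then show ?thesis using ne[of t] by blast
  qed
  moreover have "closedin X (\<Union>K)" "closedin X (\<Union>(F - K))"
    using closedin_Union_tiles[OF K(1)] closedin_Union_tiles[of "F - K"] by blast+
  ultimately show False
    using conn unfolding connected_space_closedin_eq by metis
qed

end

section \<open>Functionals over a noncommutative ring\<close>

definition module_functional ::
    "(('r::{ring,monoid_mult}) ^ 'n \<Rightarrow> 'r) \<Rightarrow> bool" where
  "module_functional f \<longleftrightarrow> (\<forall>x y. f (x + y) = f x + f y) \<and>
      (\<forall>c x. f (c *s x) = c * f x)"

definition functional_kernel ::
    "(('r::{ring,monoid_mult}) ^ 'n \<Rightarrow> 'r) \<Rightarrow> ('r ^ 'n) set" where
  "functional_kernel f = {x. f x = 0}"

definition span_one :: "('r::{ring,monoid_mult}) ^ 'n \<Rightarrow> ('r ^ 'n) set" where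
  "span_one a = range (\<lambda>c. c *s a)"

lemma scalar_simps:
  fixes x y :: "('r::{ring,monoid_mult}) ^ 'n"
  shows "(c + e) *s x = c *s x + e *s x" "(c - e) *s x = c *s x - e *s x"
    "c *s (x + y) = c *s x + c *s y" "c *s (e *s x) = (c * e) *s x" "1 *s x = x" "0 *s x = 0"
    "c *s (x - y) = c *s x - c *s y" "c *s 0 = (0 :: 'r ^ 'n)" "(- c) *s x = - (c *s x)"
  by (simp_all add: vec_eq_iff vector_scalar_mult_def algebra_simps)

lemma submodule_diff:
  assumes "submodule L" "x \<in> L" "y \<in> L"
  shows "x - y \<in> L"
proof -
  have "(- 1) *s y \<in> L" using assms unfolding submodule_def by blast
  then have "- y \<in> L" by (simp add: scalar_simps)
  then have "x + - y \<in> L" using assms unfolding submodule_def by blast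
  then show ?thesis by simp
qed

lemma
  assumes "module_functional f"
  shows functional_add: "f (x + y) = f x + f y" and functional_scale: "f (c *s x) = c * f x"
    and functional_zero: "f 0 = 0"
proof -
  show add: "f (x + y) = f x + f y" for x y using assms unfolding module_functional_def by blast
  show "f (c *s x) = c * f x" using assms unfolding module_functional_def by blast
  show "f 0 = 0" using add[of 0 0] by simp
qed

lemma functional_diff: "module_functional f \<Longrightarrow> f (x - y) = f x - f y"
  using functional_add[of f "x - y" y] by (simp add: eq_diff_eq)

lemma submodule_span_one: "submodule (span_one a)"
  unfolding submodule_def span_one_def
proof (intro conjI ballI allI)
  show "0 \<in> range (\<lambda>c. c *s a)" using scalar_simps(6)[of a] by (metis rangeI)
  fix x assume "x \<in> range (\<lambda>c. c *s a)"
  then obtain c where x: "x = c *s a" by blast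
  show "e *s x \<in> range (\<lambda>c. c *s a)" for e unfolding x scalar_simps(4) by blast
  fix y assume "y \<in> range (\<lambda>c. c *s a)"
  then obtain e where y: "y = e *s a" by blast
  show "x + y \<in> range (\<lambda>c. c *s a)" unfolding x y scalar_simps(1)[symmetric] by blast
qed

lemma submodule_functional_kernel: "module_functional f \<Longrightarrow>
    submodule (functional_kernel f)"
  unfolding submodule_def functional_kernel_def
      by (simp add: functional_add functional_scale functional_zero)

text \<open>The functional is the coordinate along a generator \<open>a\<close> of a complementary
  point; freeness of \<open>a\<close> makes this coordinate unique, and linearity follows from
  uniqueness.\<close>

lemma hyperplane_functional:
  assumes "proj_hyperplane L"
  obtains f x where "module_functional f" "L = functional_kernel f" "f x = 1"
proof -
  obtain A where L: "submodule L" "proj_point A" "complementary A L"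
    using assms unfolding proj_hyperplane_def by blast
  then obtain a where a: "A = range (\<lambda>c. c *s a)" "\<And>c. c *s a = 0 \<Longrightarrow> c =
      0"
    unfolding proj_point_def free_rank_one_def by blast
  have "\<exists>c. x - c *s a \<in> L" for x
  proof -
    have "x \<in> submodule_sum A L" using L(3) unfolding complementary_def by simp
    then obtain c h where "x = c *s a + h" "h \<in> L" unfolding submodule_sum_def a(1) by blast
    then have "x - c *s a \<in> L" by simp
    then show ?thesis by blast
  qed
  then obtain f where f: "\<And>x. x - f x *s a \<in> L" by metis
  have uniq: "f x = c" if "x - c *s a \<in> L" for x c
  proof -
    have "(x - c *s a) - (x - f x *s a) \<in> L" by (rule submodule_diff[OF L(1) that f])
    then have "(f x - c) *s a \<in> L" by (simp add: scalar_simps)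
    moreover have "(f x - c) *s a \<in> A" unfolding a(1) by blast
    ultimately have "(f x - c) *s a = 0" using L(3) unfolding complementary_def by blast
    then show ?thesis using a(2) by fastforce
  qed
  have "f (x + y) = f x + f y" for x y
  proof (rule uniq)
    have "(x - f x *s a) + (y - f y *s a) \<in> L" using L(1) f unfolding submodule_def by blast
    then show "(x + y) - (f x + f y) *s a \<in> L" by (simp add: scalar_simps algebra_simps)
  qed
  moreover have "f (c *s x) = c * f x" for c x
  proof (rule uniq)
    have "c *s (x - f x *s a) \<in> L" using L(1) f unfolding submodule_def by blast
    then show "c *s x - (c * f x) *s a \<in> L" by (simp add: scalar_simps)
  qed
  ultimately have "module_functional f" unfolding module_functional_def by blast
  moreover have "L = functional_kernel f"
  proof
    show "L \<subseteq> functional_kernel f" unfolding functional_kernel_def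
        by (auto intro!: uniq simp: scalar_simps)
    show "functional_kernel f \<subseteq> L" unfolding functional_kernel_def using f
        by auto (metis diff_zero scalar_simps(6))
  qed
  moreover have "f a = 1"
    by (rule uniq) (use L(1) in \<open>simp add: scalar_simps submodule_def\<close>)
  ultimately show thesis by (rule that)
qed

text \<open>That the sum is everything gives a left inverse of \<open>f a\<close>; that the
  intersection is trivial makes it, together with freeness, a right inverse as well.\<close>

lemma non_neighboring_unit:
  assumes f: "module_functional f" and x: "f x = 1"
    and free: "\<And>c. c *s a = 0 \<Longrightarrow> c = 0" and compl:
        "complementary (span_one a) (functional_kernel f)"
  shows "\<exists>u. f a * u = 1 \<and> u * f a = 1"
proof -
  have "x \<in> submodule_sum (span_one a) (functional_kernel f)" using compl
      unfolding complementary_def by simp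
  then obtain c h where c: "x = c *s a + h" "f h = 0"
    unfolding submodule_sum_def span_one_def functional_kernel_def by blast
  then have left: "c * f a = 1" using x by (simp add: functional_add[OF f] functional_scale[OF f])
  have "f ((f a * c - 1) *s a) = 0"
    unfolding functional_scale[OF f] using left by (simp add: left_diff_distrib mult.assoc)
  then have "(f a * c - 1) *s a \<in> span_one a \<inter> functional_kernel f"
      unfolding span_one_def functional_kernel_def by blast
  then have "(f a * c - 1) *s a = 0" using compl unfolding complementary_def by blast
  then have "f a * c - 1 = 0" by (rule free)
  then show ?thesis using left by auto
qed

lemma unit_non_neighboring:
  assumes f: "module_functional f" and u: "f a * u = 1" "u * f a = 1"
  shows "complementary (span_one a) (functional_kernel f)" "c *s a = 0 \<Longrightarrow> c = 0"
proof -
  show free: "c = 0" if "c *s a = 0" for c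
  proof -
    have "c * f a = 0" using that functional_scale[OF f, of c a] functional_zero[OF f] by simp
    then have "c * f a * u = 0" by simp
    then show ?thesis using u by (simp add: mult.assoc)
  qed
  have "x \<in> submodule_sum (span_one a) (functional_kernel f)" for x
  proof -
    have "f (x - (f x * u) *s a) = 0"
      using u by (simp add: functional_diff[OF f] functional_scale[OF f] mult.assoc)
    then have "x - (f x * u) *s a \<in> functional_kernel f" unfolding functional_kernel_def by simp
    moreover have "x = (f x * u) *s a + (x - (f x * u) *s a)" by simp
    ultimately show ?thesis unfolding submodule_sum_def span_one_def by blast
  qed
  moreover have "x = 0" if "x \<in> span_one a" "x \<in> functional_kernel f" for x
  proof -
    obtain c where c: "x = c *s a" using \<open>x \<in> span_one a\<close> unfolding span_one_def
        by blast
    have "c * f a = 0" using that(2) c functional_scale[OF f, of c a]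
        unfolding functional_kernel_def by simp
    then have "c * f a * u = 0" by simp
    then show ?thesis using u c by (simp add: mult.assoc scalar_simps)
  qed
  moreover have "0 \<in> span_one a" "0 \<in> functional_kernel f"
    using submodule_span_one submodule_functional_kernel[OF f] unfolding submodule_def by blast+
  ultimately show "complementary (span_one a) (functional_kernel f)" unfolding complementary_def
      by blast
qed

lemma proj_point_span_one:
  assumes f: "module_functional f" and u: "f a * u = 1" "u * f a = 1"
  shows "proj_point (span_one a)"
  unfolding proj_point_def free_rank_one_def
  using submodule_span_one[of a] unit_non_neighboring[OF assms] submodule_functional_kernel[OF f]
  unfolding span_one_def by blast

lemma proj_hyperplane_functional_kernel:
  assumes f: "module_functional f" and u: "f a * u = 1" "u * f a = 1"
  shows "proj_hyperplane (functional_kernel f)"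
  unfolding proj_hyperplane_def
  using submodule_functional_kernel[OF f] proj_point_span_one[OF assms] unit_non_neighboring(1)[OF assms] by blast

text \<open>On \<open>x *s a1 + y *s a2\<close> the two kernels are linear equations in
  \<open>x\<close> and \<open>y\<close> with coefficients on the right. They have the same solutions
  iff one is a right multiple of the other by a unit, and comparing coefficients turns this into the
  product being \<open>1\<close>.\<close>

lemma coherent_iff_unit_product:
  fixes a1 a2 :: "('r::{ring,monoid_mult}) ^ 'n"
  assumes f: "module_functional f1" "module_functional f2"
    and v11: "f1 a1 * v11 = 1" "v11 * f1 a1 = 1" and v12: "f2 a1 * v12 = 1" "v12 * f2 a1 = 1"
    and v21: "f1 a2 * v21 = 1" "v21 * f1 a2 = 1"
  shows "submodule_sum (span_one a1) (span_one a2) \<inter> functional_kernel f1 =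
      submodule_sum (span_one a1) (span_one a2) \<inter> functional_kernel f2 \<longleftrightarrow>
    f1 a1 * (v21 * (f2 a2 * v12)) = 1" (is "?S \<inter> _ = _ \<longleftrightarrow> _")
proof
  have S: "x *s a1 + y *s a2 \<in> ?S" for x y unfolding submodule_sum_def span_one_def by blast
  have f1: "f1 (x *s a1 + y *s a2) = x * f1 a1 + y * f1 a2" for x y
    by (simp add: functional_add[OF f(1)] functional_scale[OF f(1)])
  have f2: "f2 (x *s a1 + y *s a2) = x * f2 a1 + y * f2 a2" for x y
    by (simp add: functional_add[OF f(2)] functional_scale[OF f(2)])
  {
    assume eq: "?S \<inter> functional_kernel f1 = ?S \<inter> functional_kernel f2"
    \<comment> \<open>The solution of the first equation with \<open>y = 1\<close>; inserted into
      the second it determines \<open>f2 a2\<close>.\<close>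
    let ?z = "(- (f1 a2 * v11)) *s a1 + 1 *s a2"
    have "f1 ?z = 0" unfolding f1 using v11 by (simp add: mult.assoc)
    then have "?z \<in> ?S \<inter> functional_kernel f1" using S unfolding functional_kernel_def
        by blast
    then have "?z \<in> functional_kernel f2" using eq by blast
    then have "f2 ?z = 0" unfolding functional_kernel_def by (simp only: mem_Collect_eq)
    then have h: "f1 a2 * v11 * f2 a1 = f2 a2" unfolding f2 by simp
    have "f1 a1 * (v21 * (f2 a2 * v12)) = f1 a1 * ((v21 * f1 a2) * (v11 * (f2 a1 * v12)))"
      unfolding h[symmetric] by (simp only: mult.assoc)
    then show "f1 a1 * (v21 * (f2 a2 * v12)) = 1" using v11 v12 v21 by simp
  next
    assume one: "f1 a1 * (v21 * (f2 a2 * v12)) = 1"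
    have "f1 a1 * (v21 * f2 a2) = f1 a1 * (v21 * f2 a2) * (v12 * f2 a1)" using v12 by simp
    also have "\<dots> = f1 a1 * (v21 * (f2 a2 * v12)) * f2 a1" by (simp only: mult.assoc)
    finally have f2a1: "f2 a1 = f1 a1 * (v21 * f2 a2)" using one by simp
    have "x * f1 a1 + y * f1 a2 = 0 \<longleftrightarrow> x * f2 a1 + y * f2 a2 = 0" for x y
    proof -
      have a: "(x * f1 a1 + y * f1 a2) * (v21 * f2 a2) = x * f2 a1 + y * f2 a2"
      proof -
        have "y * f1 a2 * (v21 * f2 a2) = y * ((f1 a2 * v21) * f2 a2)" by (simp only: mult.assoc)
        then show ?thesis using v21 by (simp add: distrib_right f2a1 mult.assoc)
      qed
      \<comment> \<open>The multiplier \<open>v21 * f2 a2\<close>, which turns the first equation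
        into the second, is undone by \<open>v12 * f1 a1\<close>.\<close>
      have "(v11 * f1 a1) * (v21 * f2 a2 * (v12 * f1 a1)) =
          v11 * (f1 a1 * (v21 * (f2 a2 * v12))) * f1 a1"
        by (simp only: mult.assoc)
      then have "v21 * f2 a2 * (v12 * f1 a1) = 1" unfolding one v11 by (simp add: v11)
      then have "x * f1 a1 + y * f1 a2 = (x * f1 a1 + y * f1 a2) * (v21 * f2 a2 * (v12 * f1 a1))"
        by simp
      also have "\<dots> = (x * f2 a1 + y * f2 a2) * (v12 * f1 a1)" unfolding a[symmetric]
          by (simp only: mult.assoc)
      finally have b: "x * f1 a1 + y * f1 a2 = (x * f2 a1 + y * f2 a2) * (v12 * f1 a1)" .
      show ?thesis
      proof
        assume z: "x * f1 a1 + y * f1 a2 = 0"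
        show "x * f2 a1 + y * f2 a2 = 0" unfolding a[symmetric] z by simp
      next
        assume z: "x * f2 a1 + y * f2 a2 = 0"
        show "x * f1 a1 + y * f1 a2 = 0" unfolding b z by simp
      qed
    qed
    then have "z \<in> functional_kernel f1 \<longleftrightarrow> z \<in> functional_kernel f2" if
        "z \<in> ?S" for z
      using that f1 f2 unfolding functional_kernel_def submodule_sum_def span_one_def by auto
    then show "?S \<inter> functional_kernel f1 = ?S \<inter> functional_kernel f2" by blast
  }
qed

lemma submodule_sum_commute:
  fixes A C :: "(('r::{ring,monoid_mult}) ^ 'n) set"
  shows "submodule_sum A C = submodule_sum C A"
proof -
  have "submodule_sum A C \<subseteq> submodule_sum C A" for A C :: "('r ^ 'n) set"
  proof
    fix z assume "z \<in> submodule_sum A C"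
    then obtain x y where "z = y + x" "x \<in> A" "y \<in> C"
      unfolding submodule_sum_def by (auto simp: add.commute)
    then show "z \<in> submodule_sum C A" unfolding submodule_sum_def by blast
  qed
  then show ?thesis by blast
qed

section \<open>Holonomy and coherence\<close>

lemma holonomy_commute:
  assumes "\<And>y. y \<in> set w \<Longrightarrow> c * f y = f y * c"
  shows "c * holonomy f w = holonomy f w * c"
  using assms
proof (induction w)
  case (Cons y w)
  have "c * (f y * holonomy f w) = f y * (c * holonomy f w)"
    using Cons.prems[of y] by (simp flip: mult.assoc)
  then show ?case using Cons by (simp add: mult.assoc)
qed simp

lemma holonomy_mset_cong:
  assumes "mset v = mset w"
      "\<And>x y. \<lbrakk>x \<in> set v; y \<in> set v\<rbrakk> \<Longrightarrow> f x * f y =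
          f y * f x"
  shows "holonomy f v = holonomy f w"
  using assms
proof (induction v arbitrary: w)
  case (Cons x v)
  have "x \<in> set w" using Cons.prems(1) by (metis list.set_intros(1) mset_eq_setD)
  then obtain p q where w: "w = p @ x # q" by (meson split_list)
  have pv: "set p \<subseteq> set (x # v)" using mset_eq_setD[OF Cons.prems(1)] w by auto
  have "holonomy f v = holonomy f (p @ q)"
    using Cons.prems by (intro Cons.IH) (simp_all add: w)
  moreover have "f x * holonomy f p = holonomy f p * f x"
    by (rule holonomy_commute) (use Cons.prems(2)[of x] pv in auto)
  ultimately show ?case unfolding w by (simp add: mult.assoc[symmetric])
qed simp

lemma holonomy_concat_eq_one: "(\<And>w. w \<in> set Ws \<Longrightarrow> holonomy f w =
    1) \<Longrightarrow> holonomy f (concat Ws) = 1"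
  by (induction Ws) simp_all

text \<open>Every edge is traversed once in each direction, so everything cancels when the labels commute.\<close>

lemma holonomy_scheme_commutative:
  assumes "scheme Ws" "edge_labelling (set (concat Ws)) f"
      "\<And>x. x \<in> set (concat Ws) \<Longrightarrow> fst x \<in> A \<longleftrightarrow>
          snd x \<notin> A"
    and "\<And>x y. \<lbrakk>x \<in> set (concat Ws); y \<in> set (concat Ws)\<rbrakk> \<Longrightarrow> f x * f y = f y * f x"
  shows "holonomy f (concat Ws) = 1"
proof -
  let ?P = "\<lambda>x. fst x \<in> A"
  let ?L = "filter ?P (concat Ws)"
  \<comment> \<open>\<open>A\<close> selects one direction of each edge; the rearranged word lists
    every selected direction followed by its reversal.\<close>
  let ?M = "concat (map (\<lambda>x. [x, prod.swap x]) ?L)"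
  have sw: "x \<in> set (concat Ws) \<Longrightarrow> prod.swap x \<in> set (concat Ws)" for x
    using schemeD(2)[OF assms(1)] by blast
  have dist: "distinct (concat Ws)" by (rule schemeD[OF assms(1)])
  have "mset (concat (map (\<lambda>x. [x, prod.swap x]) l)) = mset l + mset (map prod.swap l)"
    for l :: "('a \<times> 'a) list"
    by (induction l) simp_all
  moreover have "mset (map prod.swap ?L) = mset (filter (\<lambda>x. \<not> ?P x) (concat Ws))"
  proof (subst set_eq_iff_mset_eq_distinct[symmetric])
    show "distinct (map prod.swap ?L)" using dist by (simp add: distinct_map)
    show "distinct (filter (\<lambda>x. \<not> ?P x) (concat Ws))" using dist by simp
    show "set (map prod.swap ?L) = set (filter (\<lambda>x. \<not> ?P x) (concat Ws))"
    proof (intro set_eqI iffI)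
      fix x assume "x \<in> set (map prod.swap ?L)"
      then obtain y where "y \<in> set (concat Ws)" "fst y \<in> A" "x = prod.swap y"
        unfolding set_map set_filter by blast
      then show "x \<in> set (filter (\<lambda>x. \<not> ?P x) (concat Ws))"
        using sw[of y] assms(3)[of y] unfolding set_filter by simp
    next
      fix x assume "x \<in> set (filter (\<lambda>x. \<not> ?P x) (concat Ws))"
      then have x: "x \<in> set (concat Ws)" "fst x \<notin> A" unfolding set_filter by blast+
      then have "prod.swap x \<in> set ?L" using sw[of x] assms(3)[of x] unfolding set_filter
          by simp
      then show "x \<in> set (map prod.swap ?L)" unfolding set_map by (metis image_eqI swap_swap)
    qed
  qed
  ultimately have "mset (concat Ws) = mset ?M"
      by (simp only: mset_filter multiset_partition[symmetric])
  then have "holonomy f (concat Ws) = holonomy f ?M" using assms(4) by (rule holonomy_mset_cong)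
  also have "\<dots> = 1"
  proof (rule holonomy_concat_eq_one)
    fix w assume "w \<in> set (map (\<lambda>x. [x, prod.swap x]) ?L)"
    then obtain x where x: "x \<in> set (concat Ws)" "w = [x, prod.swap x]" by auto
    then have "f x * f (prod.swap x) = 1" using assms(2) unfolding edge_labelling_def by blast
    then show "holonomy f w = 1" unfolding x(2) by simp
  qed
  finally show ?thesis .
qed

section \<open>Labellings and realizations of a tiling\<close>

locale oriented_tiling = oriented_subdivision X "B \<union> W" E F k d
  for X :: "'a topology" and B W E F k d +
  assumes four: "t \<in> F \<Longrightarrow> k t = 4"
    and disjoint: "B \<inter> W = {}"
    and coloured: "e \<in> E \<Longrightarrow>
        \<exists>b\<in>B. \<exists>w\<in>W. e \<inter> (B \<union> W) = {b, w}"
    and connected: "connected_space X"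
begin

lemma dart_coloured:
  assumes "(p, q) \<in> darts"
  shows "p \<in> B \<and> q \<in> W \<or> p \<in> W \<and> q \<in> B"
proof -
  obtain e where e: "e \<in> E" "e \<inter> (B \<union> W) = {p, q}" using assms unfolding darts_def
      by blast
  obtain b w where "b \<in> B" "w \<in> W" "{p, q} = {b, w}" using coloured[OF e(1)] unfolding e(2)
      by blast
  then show ?thesis by (auto simp: doubleton_eq_iff)
qed

text \<open>A boundary word may start at a white corner; rotating it by one step, which preserves
  flatness, gives the normal form that begins with an edge from black to white.\<close>

lemma tile_corners:
  assumes t: "t \<in> F" and f: "edge_labelling darts f"
  obtains b1 w1 b2 w2 where "t \<inter> B = {b1, b2}" "t \<inter> W = {w1, w2}"
    "b1 \<in> B" "b2 \<in> B" "w1 \<in> W" "w2 \<in> W"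
    "(b1, w1) \<in> darts" "(b2, w1) \<in> darts" "(b2, w2) \<in> darts" "(b1, w2) \<in> darts"
    "holonomy f (boundary_word t) = (1 :: 'g::monoid_mult) \<longleftrightarrow>
      f (b1, w1) * (f (w1, b2) * (f (b2, w2) * f (w2, b1))) = 1"
proof -
  define p where "p = vtx t"
  have four_Suc: "4 = Suc (Suc (Suc (Suc 0)))" by simp
  have "vtx t 4 = vtx t 0" using vtx_mod[OF t, of 4] unfolding four[OF t] by simp
  then have p4: "p (Suc (Suc (Suc (Suc 0)))) = p 0" unfolding p_def four_Suc .
  have D: "(p j, p (Suc j)) \<in> darts" for j using dart_in_darts[OF t, of j]
      unfolding dart_def p_def .
  have D': "(p (Suc j), p j) \<in> darts" for j using swap_darts[OF D[of j]] by simp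
  have Ds: "(p 0, p (Suc 0)) \<in> darts" "(p (Suc 0), p (Suc (Suc 0))) \<in> darts"
      "(p (Suc (Suc 0)), p (Suc (Suc (Suc 0)))) \<in> darts"
          "(p (Suc (Suc (Suc 0))), p 0) \<in> darts"
      "(p (Suc 0), p 0) \<in> darts" "(p (Suc (Suc 0)), p (Suc 0)) \<in> darts"
      "(p (Suc (Suc (Suc 0))), p (Suc (Suc 0))) \<in> darts"
          "(p 0, p (Suc (Suc (Suc 0)))) \<in> darts"
    using D[of "Suc (Suc (Suc 0))"] D'[of "Suc (Suc (Suc 0))"] D D' unfolding p4 by blast+
  have "{..<4} = {0, Suc 0, Suc (Suc 0), Suc (Suc (Suc 0))}"
    unfolding four_Suc lessThan_Suc lessThan_0 by blast
  then have tV: "t \<inter> (B \<union> W) =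
      {p 0, p (Suc 0), p (Suc (Suc 0)), p (Suc (Suc (Suc 0)))}"
    unfolding card_tile_vertices(1)[OF t] four[OF t] p_def by simp
  have "[0..<4] = [0, Suc 0, Suc (Suc 0), Suc (Suc (Suc 0))]"
    unfolding four_Suc by (simp only: upt.simps le0 if_True append.simps)
  then have word: "boundary_word t = [(p 0, p (Suc 0)), (p (Suc 0), p (Suc (Suc 0))),
      (p (Suc (Suc 0)), p (Suc (Suc (Suc 0)))), (p (Suc (Suc (Suc 0))), p 0)]"
    using p4 unfolding boundary_word_def four[OF t] dart_def p_def by simp
  have c: "p j \<in> B \<Longrightarrow> p (Suc j) \<in> W" "p j \<in> W \<Longrightarrow>
      p (Suc j) \<in> B" for j
    using dart_coloured[OF D[of j]] disjoint by blast+
  have tB: "t \<inter> B = {p 0, p (Suc 0), p (Suc (Suc 0)), p (Suc (Suc (Suc 0)))} \<inter> B"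
    and tW: "t \<inter> W = {p 0, p (Suc 0), p (Suc (Suc 0)), p (Suc (Suc (Suc 0)))} \<inter> W"
    unfolding tV[symmetric] by blast+
  have nB: "x \<in> W \<Longrightarrow> x \<notin> B" and nW: "x \<in> B \<Longrightarrow>
      x \<notin> W" for x using disjoint by blast+
  consider "p 0 \<in> B" | "p 0 \<in> W" using dart_coloured[OF D[of 0]] by blast
  then show thesis
  proof cases
    case 1
    note c1 = c(1)[OF 1]
    note c2 = c(2)[OF c1]
    note c3 = c(1)[OF c2]
    have tBW: "t \<inter> B = {p 0, p (Suc (Suc 0))}" "t \<inter> W =
        {p (Suc 0), p (Suc (Suc (Suc 0)))}"
      unfolding tB tW using 1 c1 c2 c3 nW[OF 1] nB[OF c1] nW[OF c2] nB[OF c3] by simp_all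
    have hol: "holonomy f (boundary_word t) = 1 \<longleftrightarrow>
      f (p 0, p (Suc 0)) * (f (p (Suc 0), p (Suc (Suc 0))) *
        (f (p (Suc (Suc 0)), p (Suc (Suc (Suc 0)))) * f (p (Suc (Suc (Suc 0))), p 0))) = 1"
      unfolding word by simp
    show thesis by (rule that[OF tBW 1 c2 c1 c3 Ds(1,6,3,8) hol])
  next
    case 2
    note c1 = c(2)[OF 2]
    note c2 = c(1)[OF c1]
    note c3 = c(2)[OF c2]
    let ?x = "(p 0, p (Suc 0))" and ?l = "[(p (Suc 0), p (Suc (Suc 0))),
      (p (Suc (Suc 0)), p (Suc (Suc (Suc 0)))), (p (Suc (Suc (Suc 0))), p 0)]"
    have tBW: "t \<inter> B = {p (Suc 0), p (Suc (Suc (Suc 0)))}" "t \<inter> W =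
        {p (Suc (Suc 0)), p 0}"
      unfolding tB tW using 2 c1 c2 c3 nB[OF 2] nW[OF c1] nB[OF c2] nW[OF c3]
      by (simp_all add: insert_commute)
    have hol: "holonomy f (boundary_word t) = 1 \<longleftrightarrow>
      f (p (Suc 0), p (Suc (Suc 0))) * (f (p (Suc (Suc 0)), p (Suc (Suc (Suc 0)))) *
        (f (p (Suc (Suc (Suc 0))), p 0) * f (p 0, p (Suc 0)))) = 1"
    proof -
      have sw: "prod.swap ` darts \<subseteq> darts" using swap_darts by blast
      have "set [?x] \<subseteq> darts" "set ?l \<subseteq> darts" using Ds by simp_all
      then have "holonomy f ([?x] @ ?l) = 1 \<longleftrightarrow> holonomy f (?l @ [?x]) = 1"
        using holonomy_rotate_eq_one[OF f _ sw, of
            "[?x]" ?l] holonomy_rotate_eq_one[OF f _ sw, of ?l "[?x]"]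
        by blast
      then show ?thesis unfolding word by simp
    qed
    show thesis by (rule that[OF tBW c1 c3 c2 2 Ds(2,7,4,5) hol])
  qed
qed

text \<open>From black to white the label is the value of the functional, so on the reversed edge it
  is the inverse, and the holonomy becomes the product in
  \<open>coherent_iff_unit_product\<close>.\<close>

lemma coherent_iff_flat:
  fixes P H :: "'a \<Rightarrow> (('r::{ring,monoid_mult}) ^ 'n) set"
  assumes t: "t \<in> F" and lab: "edge_labelling darts lab"
    and P: "\<And>b. b \<in> B \<Longrightarrow> P b = span_one (a b)"
    and H: "\<And>w. w \<in> W \<Longrightarrow> H w = functional_kernel (f w) \<and>
        module_functional (f w)"
    and lab_eq: "\<And>b w. \<lbrakk>(b, w) \<in> darts; b \<in> B\<rbrakk> \<Longrightarrow>
        lab (b, w) = f w (a b)"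
  shows "coherent B W P H t \<longleftrightarrow> holonomy lab (boundary_word t) = 1"
proof -
  obtain b1 w1 b2 w2 where tB: "t \<inter> B = {b1, b2}" and tW: "t \<inter> W = {w1, w2}"
    and mem: "b1 \<in> B" "b2 \<in> B" "w1 \<in> W" "w2 \<in> W"
    and D: "(b1, w1) \<in> darts" "(b2, w1) \<in> darts" "(b2, w2) \<in> darts"
        "(b1, w2) \<in> darts"
    and hol: "holonomy lab (boundary_word t) = 1 \<longleftrightarrow>
      lab (b1, w1) * (lab (w1, b2) * (lab (b2, w2) * lab (w2, b1))) = 1"
    by (rule tile_corners[OF t lab])
  let ?S = "submodule_sum (P b1) (P b2)"
  have "coherent B W P H t \<longleftrightarrow> ?S \<inter> H w1 = ?S \<inter> H w2"
    unfolding coherent_def tB tW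
  proof
    \<comment> \<open>\<open>coherent\<close> admits every naming of the corners; interchanging the
      black ones preserves the sum, interchanging the white ones turns the equation around.\<close>
    assume "?S \<inter> H w1 = ?S \<inter> H w2"
    moreover have "submodule_sum (P b2) (P b1) = ?S" by (rule submodule_sum_commute)
    ultimately show "\<forall>b\<^sub>1 b\<^sub>2 w\<^sub>1 w\<^sub>2. {b1, b2} =
        {b\<^sub>1, b\<^sub>2} \<and> {w1, w2} = {w\<^sub>1, w\<^sub>2} \<longrightarrow>
        submodule_sum (P b\<^sub>1) (P b\<^sub>2) \<inter> H w\<^sub>1 = submodule_sum (P b\<^sub>1) (P b\<^sub>2) \<inter> H w\<^sub>2"
      by (auto simp: doubleton_eq_iff)
  qed blast
  also have "\<dots> \<longleftrightarrow> f w1 (a b1) * (lab (w1, b2) * (f w2 (a b2) * lab (w2, b1))) = 1"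
  proof -
    have inv: "f w (a b) * lab (w, b) = 1 \<and> lab (w, b) * f w (a b) = 1"
      if "(b, w) \<in> darts" "b \<in> B" for b w
    proof -
      have "(w, b) \<in> darts" using swap_darts[OF that(1)] by simp
      then have "lab (b, w) * lab (w, b) = 1" "lab (w, b) * lab (b, w) = 1"
        using lab that(1) unfolding edge_labelling_def by force+
      then show ?thesis unfolding lab_eq[OF that] by blast
    qed
    show ?thesis
      unfolding P[OF mem(1)] P[OF mem(2)] H[OF mem(3), THEN conjunct1] H[OF mem(4), THEN conjunct1]
      by (rule coherent_iff_unit_product)
        (use H[OF mem(3)] H[OF mem(4)] inv[OF D(1) mem(1)] inv[OF D(4) mem(1)] inv[OF D(2) mem(2)] in blast)+
  qed
  also have "\<dots> \<longleftrightarrow> holonomy lab (boundary_word t) = 1"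
    unfolding hol lab_eq[OF D(1) mem(1)] lab_eq[OF D(3) mem(2)] ..
  finally show ?thesis .
qed

text \<open>Turns geometry into the hypotheses on words: orientation and the two tiles at each edge
  give the scheme, the absence of pinch points the orbits, connectedness of the surface the
  gluing.\<close>

lemma boundary_words:
  assumes "distinct Fs" "set Fs = F"
  shows "set (concat (map boundary_word Fs)) = darts"
    and "scheme (map boundary_word Fs)"
    and "one_orbit_per_vertex (map boundary_word Fs)"
    and "gluing_connected (map boundary_word Fs)"
proof -
  show D: "set (concat (map boundary_word Fs)) = darts" using assms(2) darts_eq by simp
  have inj: "inj_on boundary_word F"
  proof (rule inj_onI)
    fix t t' assume t: "t \<in> F" "t' \<in> F" "boundary_word t = boundary_word t'"
    have "dart t 0 \<in> set (boundary_word t)" "dart t 0 \<in> set (boundary_word t')"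
      using dart_in_boundary_word[OF t(1)] t(3) by simp_all
    then show "t = t'" by (rule boundary_words_disjoint[OF t(1,2)])
  qed
  have "distinct (concat (map boundary_word Fs))"
  proof (rule distinct_concat)
    show "distinct (map boundary_word Fs)" using assms inj by (simp add: distinct_map)
    fix v assume "v \<in> set (map boundary_word Fs)"
    then obtain t where t: "t \<in> F" "v = boundary_word t" using assms(2) by auto
    show "distinct v"
      using inj_on_dart[OF t(1)] unfolding t(2) boundary_word_def
          by (simp add: distinct_map atLeast0LessThan)
    fix w assume "w \<in> set (map boundary_word Fs)" "v \<noteq> w"
    then obtain t' where t': "t' \<in> F" "w = boundary_word t'" using assms(2) by auto
    with t \<open>v \<noteq> w\<close> show "set v \<inter> set w = {}"
        using boundary_words_disjoint[OF t(1) t'(1)] by blast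
  qed
  moreover have "prod.swap ` darts \<subseteq> darts" using swap_darts by blast
  moreover have "\<forall>x\<in>darts. fst x \<noteq> snd x" unfolding darts_def by auto
  ultimately show "scheme (map boundary_word Fs)" unfolding scheme_def D by blast
  show "one_orbit_per_vertex (map boundary_word Fs)"
    unfolding one_orbit_per_vertex_def D
  proof (intro allI impI ballI)
    fix S x y assume S: "\<forall>w\<in>set (map boundary_word Fs). cyc_invariant S w"
      and xy: "x \<in> darts" "y \<in> darts" "fst x = fst y"
    have inv: "\<And>t. t \<in> F \<Longrightarrow> cyc_invariant S (boundary_word t)"
        using S assms(2) by auto
    obtain p q r where "x = (p, q)" "y = (p, r)" using xy(3) by (cases x; cases y) auto
    then show "x \<in> S \<longleftrightarrow> y \<in> S" using one_orbit[OF inv] xy(1,2) by blast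
  qed
  show "gluing_connected (map boundary_word Fs)"
    unfolding gluing_connected_def
  proof (intro allI impI)
    fix K assume K: "K \<subseteq> set (map boundary_word Fs)" "K \<noteq> {}"
      "prod.swap ` (\<Union>w\<in>K. set w) \<subseteq> (\<Union>w\<in>K. set w)"
    let ?K = "{t \<in> F. boundary_word t \<in> K}"
    have KF: "K = boundary_word ` ?K" using K(1) assms(2) by auto
    have "?K = F"
    proof (rule tile_adjacency_connected[OF connected])
      show "?K \<noteq> {}" using K(2) KF by blast
      have "(\<Union>w\<in>K. set w) = (\<Union>t\<in>?K. set (boundary_word t))"
        by (subst KF) (simp only: image_image)
      with K(3) show "prod.swap ` (\<Union>t\<in>?K. set (boundary_word t)) \<subseteq> (\<Union>t\<in>?K. set (boundary_word t))"
        by (simp only:)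
    qed blast
    then show "K = set (map boundary_word Fs)" using KF assms(2) by simp
  qed
qed

end

context oriented_tiling
begin

lemma dart_nonneighboring:
  assumes "realization B W E P H" "(b, w) \<in> darts" "b \<in> B"
  shows "complementary (P b) (H w)" "w \<in> W"
proof -
  show w: "w \<in> W" using dart_coloured[OF assms(2)] assms(3) disjoint by blast
  obtain e where e: "e \<in> E" "e \<inter> (B \<union> W) = {b, w}" using assms(2)
      unfolding darts_def by blast
  then have "b \<in> e \<inter> B" "w \<in> e \<inter> W" using assms(3) w by blast+
  then show "complementary (P b) (H w)"
    using assms(1) e(1) unfolding realization_def non_neighboring_def by blast
qed

lemma incidence_if_commutative:
  fixes P H :: "'a \<Rightarrow> (('r::{ring,monoid_mult}) ^ 'n) set"
  assumes comm: "\<forall>u\<in>(ring_units :: 'r set). \<forall>v\<in>ring_units. u * v = v * u"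
    and real: "realization B W E P H" and t0: "t0 \<in> F"
    and coh: "\<And>t. \<lbrakk>t \<in> F; t \<noteq> t0\<rbrakk> \<Longrightarrow>
        coherent B W P H t"
  shows "coherent B W P H t0"
proof -
  have "\<exists>a. P b = span_one a \<and> (\<forall>c. c *s a = 0 \<longrightarrow> c = 0)" if
      "b \<in> B" for b
  proof -
    have "proj_point (P b)" using real that unfolding realization_def by blast
    then show ?thesis unfolding proj_point_def free_rank_one_def span_one_def by blast
  qed
  then obtain a where a: "\<And>b. b \<in> B \<Longrightarrow> P b = span_one (a b)"
      "\<And>b c. \<lbrakk>b \<in> B; c *s a b = 0\<rbrakk> \<Longrightarrow> c = 0"
    by metis
  have "\<exists>f. H w = functional_kernel f \<and> module_functional f \<and> (\<exists>x. f x =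
      1)" if "w \<in> W" for w
  proof -
    have "proj_hyperplane (H w)" using real that unfolding realization_def by blast
    then show ?thesis by (rule hyperplane_functional) blast
  qed
  then obtain f where f: "\<And>w. w \<in> W \<Longrightarrow> H w = functional_kernel (f w) \<and>
      module_functional (f w) \<and> (\<exists>x. f w x = 1)"
    by metis
  have unit: "\<exists>u. f w (a b) * u = 1 \<and> u * f w (a b) = 1" if bw: "(b, w) \<in> darts"
      "b \<in> B" for b w
  proof -
    note nn = dart_nonneighboring[OF real bw]
    obtain x where x: "f w x = 1" using f[OF nn(2)] by blast
    have "complementary (span_one (a b)) (functional_kernel (f w))"
      using nn(1) a(1)[OF bw(2)] f[OF nn(2)] by simp
    then show ?thesis using non_neighboring_unit[of "f w" x "a b"] f[OF nn(2)] x a(2)[OF bw(2)]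
        by blast
  qed
  define i where "i = (\<lambda>b w. SOME u. f w (a b) * u = 1 \<and> u * f w (a b) = 1)"
  have i: "f w (a b) * i b w = 1 \<and> i b w * f w (a b) = 1" if "(b, w) \<in> darts" "b \<in> B"
      for b w
    unfolding i_def by (rule someI_ex[OF unit[OF that]])
  define lab where "lab = (\<lambda>(p, q). if p \<in> B then f q (a p) else i q p)"
  have lab: "lab x * lab (prod.swap x) = 1" if "x \<in> darts" for x
  proof -
    obtain p q where x: "x = (p, q)" by (cases x)
    have "(p, q) \<in> darts" using that x by simp
    from dart_coloured[OF this] disjoint have "p \<in> B \<and> q \<notin> B \<or> q \<in> B \<and>
        p \<notin> B" by blast
    then consider "p \<in> B" "q \<notin> B" | "q \<in> B" "p \<notin> B" by blast
    then show ?thesis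
    proof cases
      case 1
      then show ?thesis using i[of p q] that unfolding x lab_def by simp
    next
      case 2
      have "(q, p) \<in> darts" using swap_darts[OF that] x by simp
      then show ?thesis using i[of q p] 2 unfolding x lab_def by simp
    qed
  qed
  then have el: "edge_labelling darts lab" unfolding edge_labelling_def by blast
  have flat: "coherent B W P H t \<longleftrightarrow> holonomy lab (boundary_word t) = 1" if
      "t \<in> F" for t
    by (rule coherent_iff_flat[OF that el a(1)]) (use f in \<open>auto simp: lab_def\<close>)
  have units: "lab x \<in> ring_units" if "x \<in> darts" for x
    using lab[OF that] lab[OF swap_darts[OF that]] unfolding ring_units_def by auto
  obtain ts where ts: "set ts = F - {t0}" "distinct ts"
    using finite_distinct_list[of "F - {t0}"] finite_F by blast
  let ?Fs = "t0 # ts"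
  have Fs: "distinct ?Fs" "set ?Fs = F" using ts t0 by auto
  note bw = boundary_words[OF Fs]
  \<comment> \<open>With \<open>t0\<close> in front, this product is the holonomy of
    \<open>t0\<close> times that of the tiles assumed coherent.\<close>
  have "holonomy lab (concat (map boundary_word ?Fs)) = 1"
  proof (rule holonomy_scheme_commutative[OF bw(2), where A = B], unfold bw(1))
    show "edge_labelling darts lab" by (rule el)
    show "fst x \<in> B \<longleftrightarrow> snd x \<notin> B" if "x \<in> darts" for x
      using dart_coloured[of "fst x" "snd x"] that disjoint by auto
    show "lab x * lab y = lab y * lab x" if "x \<in> darts" "y \<in> darts" for x y
      using comm units[OF that(1)] units[OF that(2)] by blast
  qed
  moreover have "holonomy lab (concat (map boundary_word ts)) = 1"
  proof (rule holonomy_concat_eq_one)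
    fix w assume "w \<in> set (map boundary_word ts)"
    then obtain t where t: "t \<in> F" "t \<noteq> t0" "w = boundary_word t" using ts(1) by auto
    show "holonomy lab w = 1" using coh[OF t(1,2)] flat[OF t(1)] t(3) by simp
  qed
  ultimately have "holonomy lab (boundary_word t0) = 1" by simp
  then show ?thesis using flat[OF t0] by simp
qed

text \<open>Black vertices receive distinct basis vectors, which is where the bound on
  \<open>card B\<close> enters; a functional may take any values on a basis, in particular the
  labels.\<close>

lemma realization_of_labelling:
  fixes lab :: "'a \<times> 'a \<Rightarrow> 'r::{ring,monoid_mult}"
  assumes lab: "edge_labelling darts lab" and card: "card B \<le> CARD('n::finite)"
  obtains P H :: "'a \<Rightarrow> ('r ^ 'n) set" where "realization B W E P H"
    "\<And>t. t \<in> F \<Longrightarrow> coherent B W P H t \<longleftrightarrow>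
        holonomy lab (boundary_word t) = 1"
proof -
  have "finite B" using finite_V by blast
  then obtain j :: "'a \<Rightarrow> 'n" where j: "inj_on j B"
    using card_le_inj[of B "UNIV :: 'n set"] card by auto
  define a :: "'a \<Rightarrow> 'r ^ 'n" where "a = (\<lambda>b. axis (j b) 1)"
  \<comment> \<open>Coefficients stand on the right to make \<open>f w\<close> left linear. Outside
    the image of \<open>B\<close> under \<open>j\<close> they are arbitrary labels, where the
    vectors \<open>a b\<close> with \<open>b\<close> in \<open>B\<close> have component
    \<open>0\<close>.\<close>
  define f :: "'a \<Rightarrow> 'r ^ 'n \<Rightarrow> 'r" where
    "f = (\<lambda>w x. \<Sum>m\<in>UNIV. x $ m * lab (inv_into B j m, w))"
  have fun_f: "module_functional (f w)" for w
    unfolding module_functional_def f_def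
    by (simp add: distrib_right sum.distrib vector_scalar_mult_def sum_distrib_left mult.assoc)
  have fa: "f w (a b) = lab (b, w)" if "b \<in> B" for b w
  proof -
    have "f w (a b) = (\<Sum>m\<in>UNIV. if m = j b then lab (inv_into B j m, w) else 0)"
      unfolding f_def a_def axis_def by (intro sum.cong) auto
    also have "\<dots> = lab (b, w)" using inv_into_f_f[OF j that] by simp
    finally show ?thesis .
  qed
  define P where "P = (\<lambda>b. span_one (a b))"
  define H where "H = (\<lambda>w. functional_kernel (f w))"
  have unit: "\<exists>u. f w (a b) * u = 1 \<and> u * f w (a b) = 1" if "(b, w) \<in> darts"
      "b \<in> B" for b w
  proof -
    have "(w, b) \<in> darts" using swap_darts[OF that(1)] by simp
    then have "lab (b, w) * lab (w, b) = 1" "lab (w, b) * lab (b, w) = 1"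
      using lab that(1) unfolding edge_labelling_def by force+
    then show ?thesis unfolding fa[OF that(2)] by blast
  qed
  have "proj_point (P b)" if "b \<in> B" for b
  proof -
    \<comment> \<open>Some edge at \<open>b\<close> gives a functional that is a unit on
      \<open>a b\<close>, which makes its span a point.\<close>
    have "b \<in> fst ` darts" using that fst_darts by simp
    then obtain w where "(b, w) \<in> darts" by force
    then show ?thesis using unit[OF _ that] proj_point_span_one[OF fun_f] unfolding P_def by blast
  qed
  moreover have "proj_hyperplane (H w)" if "w \<in> W" for w
  proof -
    have "w \<in> fst ` darts" using that fst_darts by simp
    then obtain b where "(w, b) \<in> darts" by force
    then have "(b, w) \<in> darts" "b \<in> B" using swap_darts[of
        "(w, b)"] dart_coloured[of w b] that disjoint by auto
    then show ?thesis using unit proj_hyperplane_functional_kernel[OF fun_f] unfolding H_def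
        by blast
  qed
  moreover have "non_neighboring (P b) (H w)"
    if ebw: "e \<in> E" "b \<in> e \<inter> B" "w \<in> e \<inter> W" for e b w
  proof -
    have "b \<noteq> w" using ebw(2,3) disjoint by blast
    obtain p q where pq: "e \<inter> (B \<union> W) = {p, q}" by (rule edge_ends[OF ebw(1)])
    have "b \<in> e \<inter> (B \<union> W)" "w \<in> e \<inter> (B \<union> W)" using ebw(2,3)
        by blast+
    then have "b \<in> {p, q}" "w \<in> {p, q}" unfolding pq .
    with \<open>b \<noteq> w\<close> have "e \<inter> (B \<union> W) = {b, w}" unfolding pq by blast
    then have "(b, w) \<in> darts" using ebw(1) \<open>b \<noteq> w\<close> unfolding darts_def
        by blast
    then show ?thesis
      using unit[of b w] ebw(2) unit_non_neighboring(1)[OF fun_f]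
          unfolding non_neighboring_def P_def H_def by blast
  qed
  ultimately have "realization B W E P H" unfolding realization_def by blast
  moreover have "coherent B W P H t \<longleftrightarrow> holonomy lab (boundary_word t) = 1" if
      "t \<in> F" for t
    by (rule coherent_iff_flat[OF that lab]) (use fun_f fa in \<open>auto simp: P_def H_def\<close>)
  ultimately show thesis by (rule that)
qed

text \<open>\<open>euler\<close> is \<chi> \<le> 0 written without subtraction; doubled, it gives
  the count for \<open>nonflat_labelling\<close>, whose labelling is realized as a counterexample
  with exceptional tile \<open>t0\<close>.\<close>

lemma commutative_if_incidence:
  assumes euler: "card (B \<union> W) + card F \<le> card E" and card:
      "card B \<le> CARD('n::finite)"
    and inc: "incidence_theorem TYPE('r::{ring,monoid_mult}) TYPE('n) B W E F"
    and u: "u \<in> (ring_units :: 'r set)" and v: "v \<in> ring_units"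
  shows "u * v = v * u"
proof (rule ccontr)
  assume noncomm: "u * v \<noteq> v * u"
  obtain u' v' where uv: "u * u' = 1" "u' * u = 1" "v * v' = 1" "v' * v = 1"
    using u v unfolding ring_units_def by blast
  have "topspace X \<noteq> {}" using surface unfolding closed_surface_def by blast
  then obtain t0 where t0: "t0 \<in> F" unfolding tiles_cover by blast
  obtain ts where ts: "set ts = F - {t0}" "distinct ts"
    using finite_distinct_list[of "F - {t0}"] finite_F by blast
  let ?Fs = "t0 # ts"
  have Fs: "distinct ?Fs" "set ?Fs = F" using ts t0 by auto
  note bw = boundary_words[OF Fs, unfolded list.map]
  have "length (concat (map boundary_word ?Fs)) = card darts"
    using distinct_card[OF schemeD(1)[OF boundary_words(2)[OF Fs]]] boundary_words(1)[OF Fs] by simp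
  moreover have "length ?Fs = card F" using distinct_card[OF Fs(1)] Fs(2) by simp
  ultimately have count: "2 * card (fst ` set (concat (boundary_word t0 # map boundary_word ts))) +
      2 * length (boundary_word t0 # map boundary_word ts)
      \<le> length (concat (boundary_word t0 # map boundary_word ts)) + 2"
    unfolding bw(1) fst_darts using euler card_darts by simp
  have "\<forall>w\<in>set (boundary_word t0 # map boundary_word ts). 2 \<le> length w"
    using four t0 ts(1) by auto
  from nonflat_labelling[OF bw(2-4) this count uv noncomm]
  obtain lab :: "'a \<times> 'a \<Rightarrow> 'r" where lab: "edge_labelling darts lab"
      "\<forall>w\<in>set (map boundary_word ts). holonomy lab w = 1"
    "holonomy lab (boundary_word t0) \<noteq> 1"
    unfolding bw(1) by blast
  obtain P H :: "'a \<Rightarrow> ('r ^ 'n) set" where PH: "realization B W E P H"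
    "\<And>t. t \<in> F \<Longrightarrow> coherent B W P H t \<longleftrightarrow>
        holonomy lab (boundary_word t) = 1"
    by (rule realization_of_labelling[OF lab(1) card]) blast
  have "\<forall>t\<in>F - {t0}. coherent B W P H t" using PH(2) lab(2) ts(1) by auto
  then have "coherent B W P H t0" using inc PH(1) t0 unfolding incidence_theorem_def by blast
  then show False using PH(2)[OF t0] lab(3) by blast
qed

end

theorem theorem8p12:
  fixes X :: "'a topology"
    and B W :: "'a set"
    and E F :: "'a set set"
    and g n :: nat
  assumes "closed_surface X" and "connected_space X"
    and "quadrilateral_tiling X B W E F"
    and "simple_subdivision (B \<union> W) E"
    and "orientable_subdivision X (B \<union> W) E F"
    and "has_genus (B \<union> W) E F g" and "g > 0"
    and "CARD('n::finite) = n + 1" and "n \<ge> card B - 1"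
  shows "incidence_theorem TYPE('r::{ring,monoid_mult}) TYPE('n) B W E F \<longleftrightarrow>
    (\<forall>u\<in>(ring_units :: 'r set). \<forall>v\<in>ring_units. u * v = v * u)"
proof -
  have sub: "polygonal_subdivision X (B \<union> W) E F"
    and quad: "\<forall>t\<in>F. \<exists>d. polygon_chart X (B \<union> W) E 4 t d"
    and BW: "B \<inter> W = {}" "\<forall>e\<in>E. \<exists>b\<in>B. \<exists>w\<in>W. e \<inter> (B \<union> W) = {b, w}"
    using assms(3) unfolding quadrilateral_tiling_def by blast+
  obtain k d where kd: "\<forall>t\<in>F. 2 \<le> k t \<and> polygon_chart X (B \<union> W) E (k t) t (d t)"
    "\<forall>t\<in>F. \<forall>t'\<in>F. t \<noteq> t' \<longrightarrow> (\<forall>i<k t. \<forall>j<k t'.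
       d t ` side (k t) i = d t' ` side (k t') j \<longrightarrow> d t (corner (k t) i) \<noteq> d t' (corner (k t') j))"
    using assms(5) unfolding orientable_subdivision_def by blast
  obtain d4 where d4: "\<forall>t\<in>F. polygon_chart X (B \<union> W) E 4 t (d4 t)" using quad by metis
  \<comment> \<open>The charts that exhibit quadrilaterals and those that exhibit the orientation
    are unrelated choices; viewing the subdivision with both allows their numbers of sides to be
    compared.\<close>
  interpret quad: charted_subdivision X "B \<union> W" E F "\<lambda>_. 4" d4
    by unfold_locales (use assms(1) sub d4 in auto)
  interpret ch: charted_subdivision X "B \<union> W" E F k d
    by unfold_locales (use assms(1) sub kd(1) in auto)
  interpret oriented_tiling X B W E F k d
  proof unfold_locales
    show "k t = 4" if "t \<in> F" for t
      using ch.card_tile_vertices(2)[OF that] quad.card_tile_vertices(2)[OF that] by simp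
    show "d t (corner (k t) i) \<noteq> d t' (corner (k t') j)"
      if "t \<in> F" "t' \<in> F" "t \<noteq> t'" "i < k t" "j < k t'" "d t ` side (k t) i = d t' ` side (k t') j"
      for t t' i j using kd(2) that by blast
  qed (use assms(2,4) BW in blast)+
  have "int (card (B \<union> W)) - int (card E) + int (card F) \<le> 0"
    using assms(6,7) unfolding has_genus_def euler_characteristic_def by simp
  then have euler: "card (B \<union> W) + card F \<le> card E" by linarith
  have card: "card B \<le> CARD('n)" using assms(8,9) by linarith
  show ?thesis
  proof
    assume "incidence_theorem TYPE('r) TYPE('n) B W E F"
    from commutative_if_incidence[OF euler card this]
    show "\<forall>u\<in>(ring_units :: 'r set). \<forall>v\<in>ring_units. u * v = v * u" by blast
  next
    assume "\<forall>u\<in>(ring_units :: 'r set). \<forall>v\<in>ring_units. u * v = v * u"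
    from incidence_if_commutative[OF this]
    show "incidence_theorem TYPE('r) TYPE('n) B W E F"
      unfolding incidence_theorem_def by blast
  qed
qed

end
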